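(* There are no cominuscule parabolic sets of roots of the exceptional simple Lie superalgebra $G(3)$.
   Context: $\mathfrak{g}=G(3)$, $\mathfrak{g}_{\bar0}\cong G_2\oplus\mathfrak{sl}(2)$, with root system $\Delta=\Delta_{\bar0}\sqcup\Delta_{\bar1}$, $\Delta_{\bar0}=\{\varepsilon_i-\varepsilon_j,\ \pm\varepsilon_i,\ \pm\gamma\mid1\le i\ne j\le3\}$, $\Delta_{\bar1}=\{\pm\tfrac{\gamma}{2},\ \pm\varepsilon_i\pm\tfrac{\gamma}{2}\mid1\le i\le3\}$, where $\varepsilon_1+\varepsilon_2+\varepsilon_3=0$. A proper subset $P\subsetneq\Delta$ is parabolic if $\Delta=P\cup(-P)$ and ($\alpha,\beta\in P$, $\alpha+\beta\in\Delta$ imply $\alpha+\beta\in P$). Its nilradical is $N^+=P\setminus(-P)$, and $P$ is cominuscule if the subalgebra $\mathfrak{n}^+=\bigoplus_{\alpha\in N^+}\mathfrak{g}^\alpha$ is abelian. *)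

theory Defs
  imports "HOL-Analysis.Analysis" "HOL-Library.Function_Algebras"
begin

section \<open>Lie superalgebras, roots, and parabolic sets of roots\<close>

text \<open>\<open>part False\<close> and \<open>part True\<close> are the even and the odd part; parities add by exclusive or.\<close>

definition parity_sign :: "bool \<Rightarrow> bool \<Rightarrow> 'k::ring_1" where
  "parity_sign p q = (if p \<and> q then - 1 else 1)"

definition graded_carrier :: "(bool \<Rightarrow> 'a::plus set) \<Rightarrow> 'a set" where
  "graded_carrier g = {u + v |u v. u \<in> g False \<and> v \<in> g True}"

locale lie_superalgebra = vector_space scale
  for scale :: "'k::field_char_0 \<Rightarrow> 'a::ab_group_add \<Rightarrow> 'a" +
  fixes part :: "bool \<Rightarrow> 'a set"
    and br :: "'a \<Rightarrow> 'a \<Rightarrow> 'a"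
  assumes subspace_part: "subspace (part p)"
    and parts_disjoint: "part False \<inter> part True = {0}"
    and br_add_left: "\<lbrakk>x \<in> graded_carrier part; y \<in> graded_carrier part; z \<in> graded_carrier part\<rbrakk> \<Longrightarrow>
        br (x + y) z = br x z + br y z"
    and br_add_right: "\<lbrakk>x \<in> graded_carrier part; y \<in> graded_carrier part; z \<in> graded_carrier part\<rbrakk> \<Longrightarrow>
        br x (y + z) = br x y + br x z"
    and br_scale_left: "\<lbrakk>x \<in> graded_carrier part; y \<in> graded_carrier part\<rbrakk> \<Longrightarrow> br (scale c x) y = scale c (br x y)"
    and br_scale_right: "\<lbrakk>x \<in> graded_carrier part; y \<in> graded_carrier part\<rbrakk> \<Longrightarrow> br x (scale c y) = scale c (br x y)"
    and br_part: "\<lbrakk>x \<in> part p; y \<in> part q\<rbrakk> \<Longrightarrow> br x y \<in> part (p \<noteq> q)"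
    and br_skew: "\<lbrakk>x \<in> part p; y \<in> part q\<rbrakk> \<Longrightarrow> br x y = - scale (parity_sign p q) (br y x)"
    and br_jacobi: "\<lbrakk>x \<in> part p; y \<in> part q; z \<in> part r\<rbrakk> \<Longrightarrow>
        br x (br y z) = br (br x y) z + scale (parity_sign p q) (br y (br x z))"
begin

text \<open>An element of the dual of a subspace \<open>h\<close> is represented by its extension by zero to the
  ambient type, so that equality of functions is equality in the dual.\<close>

definition dual :: "'a set \<Rightarrow> ('a \<Rightarrow> 'k) set" where
  "dual h = {\<alpha>. (\<forall>s\<in>h. \<forall>t\<in>h. \<alpha> (s + t) = \<alpha> s + \<alpha> t) \<and> (\<forall>c. \<forall>t\<in>h. \<alpha> (scale c t) = c * \<alpha> t)
     \<and> (\<forall>t. t \<notin> h \<longrightarrow> \<alpha> t = 0)}"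

definition root_space :: "'a set \<Rightarrow> ('a \<Rightarrow> 'k) \<Rightarrow> 'a set" where
  "root_space h \<alpha> = {x \<in> graded_carrier part. \<forall>t\<in>h. br t x = scale (\<alpha> t) x}"

definition roots :: "'a set \<Rightarrow> ('a \<Rightarrow> 'k) set" where
  "roots h = {\<alpha> \<in> dual h. \<alpha> \<noteq> 0 \<and> root_space h \<alpha> \<noteq> {0}}"

definition abelian :: "'a set \<Rightarrow> bool" where
  "abelian n \<longleftrightarrow> (\<forall>x\<in>n. \<forall>y\<in>n. br x y = 0)"

end

definition parabolic :: "'w::ab_group_add set \<Rightarrow> 'w set \<Rightarrow> bool" where
  "parabolic \<Delta> P \<longleftrightarrow> P \<subset> \<Delta> \<and> \<Delta> = P \<union> uminus ` P \<and>
     (\<forall>\<alpha>\<in>P. \<forall>\<beta>\<in>P. \<alpha> + \<beta> \<in> \<Delta> \<longrightarrow> \<alpha> + \<beta> \<in> P)"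

definition nilradical :: "'w::ab_group_add set \<Rightarrow> 'w set" where
  "nilradical P = P - uminus ` P"

definition (in lie_superalgebra) cominuscule :: "'a set \<Rightarrow> ('a \<Rightarrow> 'k) set \<Rightarrow> bool" where
  "cominuscule h P \<longleftrightarrow> parabolic (roots h) P \<and>
     abelian (span (\<Union>\<alpha>\<in>nilradical P. root_space h \<alpha>))"


section \<open>The complex octonions and their derivations\<close>

text \<open>Zorn's vector matrices: \<open>(a, v, w, b)\<close> stands for the array with diagonal entries \<open>a, b\<close>,
  upper right entry \<open>v\<close> and lower left entry \<open>w\<close>.\<close>

type_synonym oct = "complex \<times> (complex^3) \<times> (complex^3) \<times> complex"

definition dot3 :: "complex^3 \<Rightarrow> complex^3 \<Rightarrow> complex" where
  "dot3 u v = (\<Sum>i\<in>UNIV. u $ i * v $ i)"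

definition crs :: "complex^3 \<Rightarrow> complex^3 \<Rightarrow> complex^3" where
  "crs u v = vector [u $ 2 * v $ 3 - u $ 3 * v $ 2,
                     u $ 3 * v $ 1 - u $ 1 * v $ 3,
                     u $ 1 * v $ 2 - u $ 2 * v $ 1]"

fun omul :: "oct \<Rightarrow> oct \<Rightarrow> oct"  (infixl \<open>\<odot>\<close> 70) where
  "(a, v, w, b) \<odot> (a', v', w', b') =
     (a * a' + dot3 v w', a *s v' + b' *s v - crs w w', a' *s w + b *s w' + crs v v',
      b * b' + dot3 w v')"

fun oscale :: "complex \<Rightarrow> oct \<Rightarrow> oct" where
  "oscale c (a, v, w, b) = (c * a, c *s v, c *s w, c * b)"

fun otrace :: "oct \<Rightarrow> complex" where
  "otrace (a, v, w, b) = a + b"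

definition octonion_der :: "(oct \<Rightarrow> oct) set" where
  "octonion_der = {D. (\<forall>x y. D (x + y) = D x + D y) \<and> (\<forall>c x. D (oscale c x) = oscale c (D x)) \<and>
     (\<forall>x y. D (x \<odot> y) = D x \<odot> y + x \<odot> D y)}"

text \<open>The inner derivation \<open>[L x, L y] + [L x, R y] + [R x, R y]\<close>.\<close>

definition inner_der :: "oct \<Rightarrow> oct \<Rightarrow> oct \<Rightarrow> oct" where
  "inner_der x y z =
     (x \<odot> (y \<odot> z) - y \<odot> (x \<odot> z)) + (x \<odot> (z \<odot> y) - (x \<odot> z) \<odot> y) + ((z \<odot> y) \<odot> x - (z \<odot> x) \<odot> y)"


section \<open>The Lie superalgebra G(3)\<close>

text \<open>Tits' construction: the even part is \<open>Der(O) \<oplus> sl(2)\<close>, where \<open>Der(O)\<close> is the simple Lie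
  algebra of type \<open>G\<^sub>2\<close>, and the odd part is \<open>O\<^sub>0 \<otimes> \<complex>\<^sup>2\<close>, where \<open>O\<^sub>0\<close> is the 7-dimensional space
  of octonions of trace zero.  The pair \<open>(x\<^sub>1, x\<^sub>2)\<close> stands for \<open>x\<^sub>1 \<otimes> e\<^sub>1 + x\<^sub>2 \<otimes> e\<^sub>2\<close>.  With \<open>\<omega>\<close> the
  symplectic form such that \<open>\<omega>(e\<^sub>1, e\<^sub>2) = 1\<close>, the bracket of odd elements is
  \<open>[x \<otimes> u, y \<otimes> v] = \<omega>(u, v) inner_der x y + 2 tr(x y) (w \<mapsto> \<omega>(u, w) v + \<omega>(v, w) u)\<close>;
  the factor 2 is the one for which the Jacobi identity holds.\<close>

type_synonym g3 = "(oct \<Rightarrow> oct) \<times> (complex^2^2) \<times> oct \<times> oct"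

fun g3_scale :: "complex \<Rightarrow> g3 \<Rightarrow> g3" where
  "g3_scale c (D, S, x1, x2) = (\<lambda>z. oscale c (D z), \<chi> i j. c * S $ i $ j, oscale c x1, oscale c x2)"

definition g3_part :: "bool \<Rightarrow> g3 set" where
  "g3_part p = (if p then {(0, 0, x1, x2) |x1 x2. otrace x1 = 0 \<and> otrace x2 = 0}
     else {(D, S, 0, 0) |D S. D \<in> octonion_der \<and> trace S = 0})"

definition odd_sl2 :: "oct \<Rightarrow> oct \<Rightarrow> oct \<Rightarrow> oct \<Rightarrow> complex^2^2" where
  "odd_sl2 x1 x2 y1 y2 =
     (let q = otrace (x1 \<odot> y2) + otrace (x2 \<odot> y1) in
      vector [vector [- 2 * q, 4 * otrace (x1 \<odot> y1)],
              vector [- 4 * otrace (x2 \<odot> y2), 2 * q]])"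

fun g3_br :: "g3 \<Rightarrow> g3 \<Rightarrow> g3" where
  "g3_br (D, S, x1, x2) (E, T, y1, y2) =
     ((D \<circ> E) - (E \<circ> D) + (inner_der x1 y2 - inner_der x2 y1),
      S ** T - T ** S + odd_sl2 x1 x2 y1 y2,
      (D y1 + oscale (S $ 1 $ 1) y1 + oscale (S $ 1 $ 2) y2)
        - (E x1 + oscale (T $ 1 $ 1) x1 + oscale (T $ 1 $ 2) x2),
      (D y2 + oscale (S $ 2 $ 1) y1 + oscale (S $ 2 $ 2) y2)
        - (E x2 + oscale (T $ 2 $ 1) x1 + oscale (T $ 2 $ 2) x2))"

definition cartan_elt :: "complex^3 \<Rightarrow> complex \<Rightarrow> g3" where
  "cartan_elt a b = (\<lambda>(s, v, w, t). (0, \<chi> i. a $ i * v $ i, \<chi> i. - (a $ i * w $ i), 0),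
     vector [vector [b, 0], vector [0, - b]], 0, 0)"

definition g3_cartan :: "g3 set" where
  "g3_cartan = {cartan_elt a b |a b. a $ 1 + a $ 2 + a $ 3 = 0}"

text \<open>On \<open>cartan_elt a b\<close>, \<open>eps i\<close> is the eigenvalue \<open>a $ i\<close> on the \<open>i\<close>-th upper right unit octonion,
  and \<open>half_gamma\<close> is \<open>b\<close>.\<close>

definition eps :: "3 \<Rightarrow> g3 \<Rightarrow> complex" where
  "eps i t = (if t \<in> g3_cartan then fst (snd (fst t (0, axis i 1, 0, 0))) $ i else 0)"

definition half_gamma :: "g3 \<Rightarrow> complex" where
  "half_gamma t = (if t \<in> g3_cartan then fst (snd t) $ 1 $ 1 else 0)"

definition gamma :: "g3 \<Rightarrow> complex" where
  "gamma = half_gamma + half_gamma"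

definition g3_even_roots :: "(g3 \<Rightarrow> complex) set" where
  "g3_even_roots = {eps i - eps j |i j. i \<noteq> j} \<union> (\<Union>i. {eps i, - eps i})
     \<union> {gamma, - gamma}"

definition g3_odd_roots :: "(g3 \<Rightarrow> complex) set" where
  "g3_odd_roots = {half_gamma, - half_gamma}
     \<union> (\<Union>i. {eps i + half_gamma, eps i - half_gamma, - eps i + half_gamma, - eps i - half_gamma})"

subsection \<open>Octonion identities\<close>

lemmas oct_expand = dot3_def crs_def vec_eq_iff forall_3 sum_3 vector_3 zero_prod_def

lemma omul_add_left: "(x + y) \<odot> z = x \<odot> z + y \<odot> z"
  by (cases x; cases y; cases z) (simp add: oct_expand algebra_simps)
lemma omul_add_right: "x \<odot> (y + z) = x \<odot> y + x \<odot> z"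
  by (cases x; cases y; cases z) (simp add: oct_expand algebra_simps)
lemma omul_scale_left: "oscale c x \<odot> y = oscale c (x \<odot> y)"
  by (cases x; cases y) (simp add: oct_expand algebra_simps)
lemma omul_scale_right: "x \<odot> oscale c y = oscale c (x \<odot> y)"
  by (cases x; cases y) (simp add: oct_expand algebra_simps)
lemma oscale_vector_space: "vector_space oscale"
proof
  fix c d x y
  show "oscale c (x + y) = oscale c x + oscale c y"
    by (cases x; cases y) (simp add: oct_expand algebra_simps)
  show "oscale (c + d) x = oscale c x + oscale d x"
    by (cases x) (simp add: oct_expand algebra_simps)
  show "oscale c (oscale d x) = oscale (c * d) x"
    by (cases x) (simp add: oct_expand algebra_simps)
  show "oscale 1 x = x"
    by (cases x) (simp add: oct_expand)
qed
interpretation O: vector_space oscale by (rule oscale_vector_space)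
lemma omul_diff_left: "(x - y) \<odot> z = x \<odot> z - y \<odot> z"
  using omul_add_left[of "x - y" y z] by (simp add: algebra_simps)
lemma omul_diff_right: "x \<odot> (y - z) = x \<odot> y - x \<odot> z"
  using omul_add_right[of x "y - z" z] by (simp add: algebra_simps)
lemma omul_zero[simp]: "0 \<odot> x = 0" "x \<odot> 0 = 0"
  using omul_add_left[of 0 0 x] omul_add_right[of x 0 0] by auto
lemma omul_minus_left: "(- x) \<odot> z = - (x \<odot> z)"
  using omul_diff_left[of 0 x z] by simp
lemma omul_minus_right: "x \<odot> (- z) = - (x \<odot> z)"
  using omul_diff_right[of x 0 z] by simp
lemmas omul_lin = omul_add_left omul_add_right omul_diff_left omul_diff_right
  omul_minus_left omul_minus_right

lemma alt_left: "x \<odot> (x \<odot> y) = (x \<odot> x) \<odot> y"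
  by (cases x; cases y) (simp add: oct_expand algebra_simps)
lemma alt_right: "(y \<odot> x) \<odot> x = y \<odot> (x \<odot> x)"
  by (cases x; cases y) (simp add: oct_expand algebra_simps)

lemma otrace_add: "otrace (x + y) = otrace x + otrace y"
  by (cases x; cases y) simp
lemma otrace_scale: "otrace (oscale c x) = c * otrace x"
  by (cases x) (simp add: algebra_simps)
lemma otrace_zero[simp]: "otrace 0 = 0" by (simp add: zero_prod_def)
lemma otrace_minus: "otrace (- x) = - otrace x" by (cases x) simp
lemma otrace_diff: "otrace (x - y) = otrace x - otrace y"
  by (cases x; cases y) simp
lemma otrace_comm: "otrace (x \<odot> y) = otrace (y \<odot> x)"
  by (cases x; cases y) (simp add: oct_expand algebra_simps)
lemmas otrace_lin = otrace_add otrace_diff otrace_minus otrace_scale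

lemma inner_der_cubic:
  assumes "otrace x = 0" "otrace y = 0"
  shows "inner_der x y x = oscale (2 * otrace (x \<odot> y)) x - oscale (2 * otrace (x \<odot> x)) y"
proof -
  obtain a v w b where x: "x = (a, v, w, b)" by (cases x)
  obtain c s t d where y: "y = (c, s, t, d)" by (cases y)
  have "b = - a" "d = - c" using assms by (auto simp: x y eq_neg_iff_add_eq_0 algebra_simps)
  then show ?thesis unfolding x y inner_der_def
    by (simp add: oct_expand algebra_simps)
qed

definition oassoc :: "oct \<Rightarrow> oct \<Rightarrow> oct \<Rightarrow> oct" where
  "oassoc x y z = (x \<odot> y) \<odot> z - x \<odot> (y \<odot> z)"

lemma oassoc_swap12: "oassoc x y z = - oassoc y x z"
proof -
  have "oassoc (x + y) (x + y) z = 0" "oassoc x x z = 0" "oassoc y y z = 0"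
    by (simp_all add: oassoc_def alt_left)
  then show ?thesis
    by (simp add: oassoc_def omul_lin algebra_simps eq_neg_iff_add_eq_0)
qed

lemma oassoc_swap23: "oassoc z x y = - oassoc z y x"
proof -
  have "oassoc z (x + y) (x + y) = 0" "oassoc z x x = 0" "oassoc z y y = 0"
    by (simp_all add: oassoc_def alt_right)
  then show ?thesis
    by (simp add: oassoc_def omul_lin algebra_simps eq_neg_iff_add_eq_0)
qed

definition triality_triple :: "(oct \<Rightarrow> oct) \<Rightarrow> (oct \<Rightarrow> oct) \<Rightarrow> (oct \<Rightarrow> oct) \<Rightarrow> bool" where
  "triality_triple A B C \<longleftrightarrow> (\<forall>x y. A (x + y) = A x + A y) \<and> (\<forall>z w. A (z \<odot> w) = B z \<odot> w + z \<odot> C w)"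

lemma triality_triple_commutator:
  assumes "triality_triple A B C" "triality_triple A' B' C'"
  shows "A (A' (z \<odot> w)) - A' (A (z \<odot> w))
    = (B (B' z) - B' (B z)) \<odot> w + z \<odot> (C (C' w) - C' (C w))"
  using assms by (simp add: triality_triple_def omul_lin algebra_simps del: split_paired_All)

lemma triality_LR: "triality_triple (\<lambda>z. a \<odot> z + z \<odot> a) (\<lambda>z. a \<odot> z) (\<lambda>z. z \<odot> a)"
proof -
  have "oassoc a z w = oassoc z w a" for z w
    by (metis oassoc_swap12 oassoc_swap23 minus_minus)
  then show ?thesis
    by (simp add: triality_triple_def omul_lin oassoc_def algebra_simps)
qed

lemma triality_L: "triality_triple (\<lambda>z. a \<odot> z) (\<lambda>z. a \<odot> z + z \<odot> a) (\<lambda>z. - (a \<odot> z))"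
proof -
  have "oassoc a z w = - oassoc z a w" for z w
    by (rule oassoc_swap12)
  then show ?thesis
    by (simp add: triality_triple_def omul_lin oassoc_def algebra_simps)
qed

lemma triality_R: "triality_triple (\<lambda>z. z \<odot> a) (\<lambda>z. - (z \<odot> a)) (\<lambda>z. a \<odot> z + z \<odot> a)"
proof -
  have "oassoc z w a = - oassoc z a w" for z w
    by (rule oassoc_swap23)
  then show ?thesis
    by (simp add: triality_triple_def omul_lin oassoc_def algebra_simps)
qed

lemma inner_der_add:
  "inner_der (x + x') y z = inner_der x y z + inner_der x' y z"
  "inner_der x (y + y') z = inner_der x y z + inner_der x y' z"
  "inner_der x y (z + z') = inner_der x y z + inner_der x y z'"
  by (simp_all add: inner_der_def omul_lin algebra_simps)

lemma inner_der_scale: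
  "inner_der (oscale c x) y z = oscale c (inner_der x y z)"
  "inner_der x (oscale c y) z = oscale c (inner_der x y z)"
  "inner_der x y (oscale c z) = oscale c (inner_der x y z)"
  by (simp_all add: inner_der_def omul_scale_left omul_scale_right O.scale_right_distrib
      O.scale_right_diff_distrib)

lemma inner_der_LR_RL: "x \<odot> (z \<odot> y) - (x \<odot> z) \<odot> y = (y \<odot> z) \<odot> x - y \<odot> (z \<odot> x)"
proof -
  have "oassoc y z x = - oassoc x z y"
    by (metis oassoc_swap12 oassoc_swap23 minus_minus)
  then show ?thesis by (simp add: oassoc_def algebra_simps)
qed

lemma inner_der_skew: "inner_der y x z = - inner_der x y z"
  using inner_der_LR_RL[of x z y] by (simp add: inner_der_def algebra_simps)

lemma inner_der_double:
  "inner_der x y z + inner_der x y z =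
     (x \<odot> (y \<odot> z) - y \<odot> (x \<odot> z)) + ((z \<odot> y) \<odot> x - (z \<odot> x) \<odot> y)
     + ((x \<odot> (y \<odot> z + z \<odot> y) + (y \<odot> z + z \<odot> y) \<odot> x) - (y \<odot> (x \<odot> z + z \<odot> x) + (x \<odot> z + z \<odot> x) \<odot> y))"
proof -
  have "inner_der x y z + inner_der x y z =
     (x \<odot> (y \<odot> z) - y \<odot> (x \<odot> z)) + (x \<odot> (z \<odot> y) - (x \<odot> z) \<odot> y) + ((z \<odot> y) \<odot> x - (z \<odot> x) \<odot> y)
    + ((x \<odot> (y \<odot> z) - y \<odot> (x \<odot> z)) + ((y \<odot> z) \<odot> x - y \<odot> (z \<odot> x)) + ((z \<odot> y) \<odot> x - (z \<odot> x) \<odot> y))"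
    unfolding inner_der_def using inner_der_LR_RL[of x z y] by simp
  then show ?thesis by (simp add: omul_lin algebra_simps)
qed

lemma inner_der_in_octonion_der: "inner_der x y \<in> octonion_der"
proof -
  have "inner_der x y (z \<odot> w) = inner_der x y z \<odot> w + z \<odot> inner_der x y w" for z w
  proof -
    note t = triality_triple_commutator[OF triality_LR[of x] triality_LR[of y]]
      triality_triple_commutator[OF triality_L[of x] triality_L[of y]]
      triality_triple_commutator[OF triality_R[of x] triality_R[of y]]
    have "inner_der x y (z \<odot> w) + inner_der x y (z \<odot> w)
      = (inner_der x y z + inner_der x y z) \<odot> w + z \<odot> (inner_der x y w + inner_der x y w)"
      unfolding inner_der_double t using t[of z w] by (simp add: omul_lin algebra_simps)
    then have "oscale 2 (inner_der x y (z \<odot> w)) = oscale 2 (inner_der x y z \<odot> w + z \<odot> inner_der x y w)"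
      by (simp add: omul_lin O.scale_left_distrib[of 1 1, simplified] algebra_simps)
    then show ?thesis by (subst (asm) O.scale_cancel_left) simp
  qed
  then show ?thesis
    unfolding octonion_der_def by (simp add: inner_der_add inner_der_scale del: split_paired_All)
qed

lemma octonion_derD:
  assumes "D \<in> octonion_der"
  shows "D (x + y) = D x + D y" "D (oscale c x) = oscale c (D x)"
    "D (x \<odot> y) = D x \<odot> y + x \<odot> D y" "D 0 = 0" "D (- x) = - D x" "D (x - y) = D x - D y"
proof -
  show a: "D (x + y) = D x + D y" for x y using assms unfolding octonion_der_def by blast
  show "D (oscale c x) = oscale c (D x)" "D (x \<odot> y) = D x \<odot> y + x \<odot> D y"
    using assms unfolding octonion_der_def by blast+
  show z: "D 0 = 0" using a[of 0 0] by simp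
  show m: "D (- x) = - D x" for x using a[of x "- x"] z by (simp add: eq_neg_iff_add_eq_0 add.commute)
  show "D (x - y) = D x - D y" using a[of x "- y"] m by simp
qed

lemma octonion_der_one: "D \<in> octonion_der \<Longrightarrow> D (1, 0, 0, 1) = 0"
proof -
  assume D: "D \<in> octonion_der"
  have 1: "(1, 0, 0, 1) \<odot> z = z" "z \<odot> (1, 0, 0, 1) = z" for z
    by (cases z; simp add: oct_expand)+
  show ?thesis using octonion_derD(3)[OF D, of "(1,0,0,1)" "(1,0,0,1)"] by (simp only: 1) simp
qed

lemma octonion_der_otrace: 
  assumes D: "D \<in> octonion_der"
  shows "otrace (D x) = 0"
proof (rule ccontr)
  assume nz: "otrace (D x) \<noteq> 0"
  have quad: "\<exists>n. z \<odot> z = oscale (otrace z) z + oscale n (1, 0, 0, 1)" for z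
  proof -
    obtain a v w b where z: "z = (a, v, w, b)" by (cases z)
    show ?thesis by (rule exI[of _ "dot3 v w - a * b"]) (simp add: z oct_expand algebra_simps)
  qed
  have lin: "\<exists>n. u \<odot> z + z \<odot> u = oscale (otrace z) u + oscale (otrace u) z + oscale n (1, 0, 0, 1)" for u z
  proof -
    obtain l m n where "u \<odot> u = oscale (otrace u) u + oscale l (1, 0, 0, 1)"
      "z \<odot> z = oscale (otrace z) z + oscale m (1, 0, 0, 1)"
      "(u + z) \<odot> (u + z) = oscale (otrace (u + z)) (u + z) + oscale n (1, 0, 0, 1)"
      using quad by metis
    then have "u \<odot> z + z \<odot> u = oscale (otrace z) u + oscale (otrace u) z + oscale (n - l - m) (1, 0, 0, 1)"
      by (simp only: omul_lin otrace_lin O.scale_left_distrib O.scale_right_distrib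
          O.scale_left_diff_distrib) (simp add: algebra_simps del: oscale.simps)
    then show ?thesis by blast
  qed
  obtain m where m: "x \<odot> x = oscale (otrace x) x + oscale m (1, 0, 0, 1)" using quad by blast
  have "D x \<odot> x + x \<odot> D x = oscale (otrace x) (D x)"
    using arg_cong[OF m, of D]
    by (simp only: octonion_derD[OF D] octonion_der_one[OF D]) simp
  moreover obtain n where "D x \<odot> x + x \<odot> D x = oscale (otrace x) (D x) + oscale (otrace (D x)) x + oscale n (1, 0, 0, 1)"
    using lin by blast
  ultimately have "oscale (otrace (D x)) x = oscale (- n) (1, 0, 0, 1)"
    by (simp only: O.scale_minus_left) (simp del: oscale.simps add: algebra_simps eq_neg_iff_add_eq_0)
  then have "oscale (otrace (D x)) (D x) = 0"
    using octonion_derD(2)[OF D] octonion_der_one[OF D] by (metis O.scale_zero_right)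
  then show False using nz by (auto simp: O.scale_eq_0_iff)
qed

lemma octonion_der_otrace_mult:
  assumes D: "D \<in> octonion_der"
  shows "otrace (D x \<odot> y) = - otrace (x \<odot> D y)"
  using octonion_der_otrace[OF D, of "x \<odot> y"]
  by (simp add: octonion_derD[OF D] otrace_lin eq_neg_iff_add_eq_0)

lemma octonion_der_commutator:
  assumes D: "D \<in> octonion_der" and E: "E \<in> octonion_der"
  shows "(D \<circ> E) - (E \<circ> D) \<in> octonion_der"
  unfolding octonion_der_def
  by (simp add: octonion_derD[OF D] octonion_derD[OF E] omul_lin O.scale_right_diff_distrib
      algebra_simps del: split_paired_All)

lemma octonion_der_lin:
  "D \<in> octonion_der \<Longrightarrow> E \<in> octonion_der \<Longrightarrow> D + E \<in> octonion_der"
  "D \<in> octonion_der \<Longrightarrow> E \<in> octonion_der \<Longrightarrow> D - E \<in> octonion_der"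
  "D \<in> octonion_der \<Longrightarrow> (\<lambda>z. oscale c (D z)) \<in> octonion_der"
  "0 \<in> octonion_der"
    by (simp_all add: octonion_der_def omul_lin O.scale_right_diff_distrib O.scale_right_distrib
      O.scale_left_commute omul_scale_left omul_scale_right
      algebra_simps del: split_paired_All)

lemma octonion_der_inner_der:
  assumes D: "D \<in> octonion_der"
  shows "D (inner_der x y z) = inner_der (D x) y z + inner_der x (D y) z + inner_der x y (D z)"
  by (simp add: inner_der_def octonion_derD[OF D] omul_lin algebra_simps)

lemma inner_der_cubic_lin:
  assumes "otrace x = 0" "otrace y = 0" "otrace z = 0"
  shows "inner_der x y z + inner_der z y x =
    oscale (2 * otrace (x \<odot> y)) z + oscale (2 * otrace (z \<odot> y)) x - oscale (4 * otrace (x \<odot> z)) y"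
proof -
  have "inner_der (x + z) y (x + z) = oscale (2 * otrace ((x + z) \<odot> y)) (x + z) - oscale (2 * otrace ((x + z) \<odot> (x + z))) y"
    "inner_der x y x = oscale (2 * otrace (x \<odot> y)) x - oscale (2 * otrace (x \<odot> x)) y"
    "inner_der z y z = oscale (2 * otrace (z \<odot> y)) z - oscale (2 * otrace (z \<odot> z)) y"
    using assms by (auto intro!: inner_der_cubic simp: otrace_add)
  moreover have "otrace (z \<odot> x) = otrace (x \<odot> z)" by (rule otrace_comm)
  ultimately show ?thesis
    by (simp add: inner_der_add otrace_lin omul_lin O.scale_right_distrib O.scale_left_distrib algebra_simps
       O.scale_left_distrib[of "otrace _ * 2" "otrace _ * 2", simplified mult_2_right[symmetric]]) 
qed

subsection \<open>The Lie superalgebra axioms\<close>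

lemmas mat2_expand = vec_eq_iff forall_2 matrix_matrix_mult_def sum_2 vector_2 odd_sl2_def Let_def

lemma g3_total:
  "graded_carrier g3_part =
   {(D, S, x1, x2) |D S x1 x2. D \<in> octonion_der \<and> trace S = 0 \<and> otrace x1 = 0 \<and> otrace x2 = 0}"
  unfolding g3_part_def graded_carrier_def
  by (force simp del: split_paired_All split_paired_Ex)

lemma g3_scale_vector_space: "vector_space g3_scale"
proof
  fix c d :: complex and x y :: g3
  obtain D S x1 x2 where x: "x = (D, S, x1, x2)" by (cases x)
  obtain E T y1 y2 where y: "y = (E, T, y1, y2)" by (cases y)
  show "g3_scale c (x + y) = g3_scale c x + g3_scale c y"
    by (simp add: x y fun_eq_iff vec_eq_iff O.scale_right_distrib algebra_simps del: split_paired_All)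
  show "g3_scale (c + d) x = g3_scale c x + g3_scale d x"
    by (simp add: x y fun_eq_iff vec_eq_iff O.scale_left_distrib algebra_simps del: split_paired_All)
  show "g3_scale c (g3_scale d x) = g3_scale (c * d) x"
    by (simp add: x y fun_eq_iff vec_eq_iff algebra_simps del: split_paired_All)
  show "g3_scale 1 x = x"
    by (simp add: x y fun_eq_iff vec_eq_iff algebra_simps del: split_paired_All)
qed

interpretation V: vector_space g3_scale by (rule g3_scale_vector_space)

lemma inner_der_zero[simp]: "inner_der 0 y = 0" "inner_der x 0 = 0"
  by (simp_all add: inner_der_def fun_eq_iff del: split_paired_All)

lemma odd_sl2_zero[simp]: "odd_sl2 0 0 y1 y2 = 0" "odd_sl2 x1 x2 0 0 = 0"
  by (simp_all add: mat2_expand)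

lemma odd_sl2_sym: "odd_sl2 x1 x2 y1 y2 = odd_sl2 y1 y2 x1 x2"
  by (simp add: mat2_expand otrace_comm[of x1] otrace_comm[of x2] add.commute)

lemma inner_der_fun_skew: "inner_der y x = - inner_der x y"
  by (simp add: fun_eq_iff inner_der_skew[of y x] del: split_paired_All)

lemma zero_g3: "(0::g3) = (0, 0, 0, 0)" by (simp add: zero_prod_def)

lemma inner_der_lin:
  "inner_der (x + x') y z = inner_der x y z + inner_der x' y z"
  "inner_der x (y + y') z = inner_der x y z + inner_der x y' z"
  "inner_der x y (z + z') = inner_der x y z + inner_der x y z'"
  "inner_der (x - x') y z = inner_der x y z - inner_der x' y z"
  "inner_der x (y - y') z = inner_der x y z - inner_der x y' z"
  "inner_der x y (z - z') = inner_der x y z - inner_der x y z'"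
  "inner_der (- x) y z = - inner_der x y z"
  "inner_der x (- y) z = - inner_der x y z"
  "inner_der x y (- z) = - inner_der x y z"
  by (simp_all add: inner_der_def omul_lin algebra_simps)

lemmas g3_lin = inner_der_lin inner_der_scale O.scale_right_distrib O.scale_right_diff_distrib
  O.scale_left_distrib O.scale_left_diff_distrib omul_lin omul_scale_left omul_scale_right otrace_lin

lemma g3_part_iff:
  "(D, S, x1, x2) \<in> g3_part False \<longleftrightarrow> D \<in> octonion_der \<and> trace S = 0 \<and> x1 = 0 \<and> x2 = 0"
  "(D, S, x1, x2) \<in> g3_part True \<longleftrightarrow> D = 0 \<and> S = 0 \<and> otrace x1 = 0 \<and> otrace x2 = 0"
  unfolding g3_part_def by (simp_all del: split_paired_Ex) blast+

lemma g3_even_cases: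
  assumes "x \<in> g3_part False"
  obtains D S where "x = (D, S, 0, 0)" "D \<in> octonion_der" "S $ 2 $ 2 = - (S $ 1 $ 1)"
  using assms by (cases x) (auto simp: g3_part_iff trace_def sum_2 eq_neg_iff_add_eq_0 add.commute)

lemma g3_odd_cases:
  assumes "x \<in> g3_part True"
  obtains x1 x2 where "x = (0, 0, x1, x2)" "otrace x1 = 0" "otrace x2 = 0"
  using assms by (cases x) (auto simp: g3_part_iff)

lemma trace0_2: "trace (S :: complex^2^2) = 0 \<longleftrightarrow> S $ 2 $ 2 = - (S $ 1 $ 1)"
  by (auto simp: trace_def sum_2 eq_neg_iff_add_eq_0 add.commute)

lemma g3_part_ball:
  "(\<forall>x\<in>g3_part False. Q x) \<longleftrightarrow> (\<forall>D S. D \<in> octonion_der \<longrightarrow> S $ 2 $ 2 = - (S $ 1 $ 1) \<longrightarrow> Q (D, S, 0, 0))"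
  "(\<forall>x\<in>g3_part True. Q x) \<longleftrightarrow> (\<forall>x1 x2. otrace x1 = 0 \<longrightarrow> otrace x2 = 0 \<longrightarrow> Q (0, 0, x1, x2))"
  by (metis g3_even_cases g3_part_iff(1) trace0_2) (metis g3_odd_cases g3_part_iff(2))

lemma comp_zero: "(0 :: oct \<Rightarrow> oct) \<circ> D = 0" "D \<in> octonion_der \<Longrightarrow> D \<circ> (0 :: oct \<Rightarrow> oct) = 0"
  by (simp_all add: fun_eq_iff octonion_derD del: split_paired_All)

lemma mat_zero: "(0 :: complex^2^2) ** S = 0" "S ** (0 :: complex^2^2) = 0"
  by (simp_all add: matrix_matrix_mult_def vec_eq_iff)

lemma oct_zero_scale: "oscale c 0 = 0" "oscale 0 x = 0" by (rule O.scale_zero_right O.scale_zero_left)+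

lemma g3_subspace: "V.subspace (g3_part p)"
  unfolding V.subspace_def
  by (cases p) (simp_all add: g3_part_ball zero_g3 g3_part_iff otrace_lin O.scale_zero_right
      octonion_der_lin trace0_2 zero_fun_def[symmetric] vec_eq_iff
      del: oscale.simps split_paired_All)

lemmas g3_br_simps = comp_zero mat_zero oct_zero_scale octonion_derD(4) octonion_der_lin(4)

lemma g3_br_even_even: "D \<in> octonion_der \<Longrightarrow> E \<in> octonion_der \<Longrightarrow>
  g3_br (D, S, 0, 0) (E, T, 0, 0) = ((D \<circ> E) - (E \<circ> D), S ** T - T ** S, 0, 0)"
  by (simp add: g3_br_simps)

lemma g3_br_even_odd: "D \<in> octonion_der \<Longrightarrow> g3_br (D, S, 0, 0) (0, 0, y1, y2) =
   (0, 0, D y1 + oscale (S $ 1 $ 1) y1 + oscale (S $ 1 $ 2) y2,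
      D y2 + oscale (S $ 2 $ 1) y1 + oscale (S $ 2 $ 2) y2)"
  by (simp add: g3_br_simps)

lemma g3_br_odd_even: "D \<in> octonion_der \<Longrightarrow> g3_br (0, 0, y1, y2) (D, S, 0, 0) =
   (0, 0, - (D y1 + oscale (S $ 1 $ 1) y1 + oscale (S $ 1 $ 2) y2),
      - (D y2 + oscale (S $ 2 $ 1) y1 + oscale (S $ 2 $ 2) y2))"
  by (simp add: g3_br_simps)

lemma g3_br_odd_odd: "g3_br (0, 0, x1, x2) (0, 0, y1, y2) =
   (inner_der x1 y2 - inner_der x2 y1, odd_sl2 x1 x2 y1 y2, 0, 0)"
  by (simp add: g3_br_simps)

lemmas g3_br_parts = g3_br_even_even g3_br_even_odd g3_br_odd_even g3_br_odd_odd

lemma g3_br_part: "\<forall>x\<in>g3_part p. \<forall>y\<in>g3_part q. g3_br x y \<in> g3_part (p \<noteq> q)"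
  by (cases p; cases q)
     (simp_all add: g3_part_ball g3_br_parts g3_part_iff trace0_2
       octonion_der_commutator octonion_der_otrace otrace_lin
       octonion_der_lin(2) inner_der_in_octonion_der
       mat2_expand algebra_simps del: g3_br.simps split_paired_All)

lemma g3_br_skew:
  "\<forall>x\<in>g3_part p. \<forall>y\<in>g3_part q. g3_br x y = - g3_scale (parity_sign p q) (g3_br y x)"
  apply (cases p; cases q)
     apply (simp_all add: g3_part_ball g3_br_parts parity_sign_def 
       fun_eq_iff vec_eq_iff  O.scale_zero_right
       del: g3_br.simps split_paired_All)
  apply (metis odd_sl2_sym inner_der_skew diff_conv_add_uminus add.commute)
  done

lemma oscale_numeral: "oscale (2 * c) x = oscale c x + oscale c x"
  "oscale (4 * c) x = oscale c x + oscale c x + oscale c x + oscale c x"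
  by (simp_all add: O.scale_left_distrib[symmetric])

lemma inner_der_cubic_swap:
  assumes "otrace x = 0" "otrace y = 0" "otrace z = 0"
  shows "inner_der x y z = oscale (2 * otrace (x \<odot> y)) z + oscale (2 * otrace (z \<odot> y)) x
    - oscale (4 * otrace (x \<odot> z)) y - inner_der z y x"
  using inner_der_cubic_lin[OF assms] by (simp only: eq_diff_eq)

lemma g3_jacobi_odd:
  assumes "otrace x1 = 0" "otrace x2 = 0" "otrace y1 = 0" "otrace y2 = 0" "otrace z1 = 0" "otrace z2 = 0"
  shows "g3_br (0, 0, x1, x2) (g3_br (0, 0, y1, y2) (0, 0, z1, z2)) =
    g3_br (g3_br (0, 0, x1, x2) (0, 0, y1, y2)) (0, 0, z1, z2)
    - g3_br (0, 0, y1, y2) (g3_br (0, 0, x1, x2) (0, 0, z1, z2))"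
proof -
  have D: "inner_der u v - inner_der u' v' \<in> octonion_der" for u v u' v'
    by (rule octonion_der_lin(2)) (rule inner_der_in_octonion_der)+
  note s = otrace_comm[of y1 x1] otrace_comm[of y1 x2] otrace_comm[of y2 x1] otrace_comm[of y2 x2]
    otrace_comm[of z1 x1] otrace_comm[of z1 x2] otrace_comm[of z2 x1] otrace_comm[of z2 x2]
    otrace_comm[of z1 y1] otrace_comm[of z1 y2] otrace_comm[of z2 y1] otrace_comm[of z2 y2]
  show ?thesis
    apply (simp add: g3_br_odd_odd g3_br_even_odd[OF D] g3_br_odd_even[OF D] del: g3_br.simps)
    apply (simp add: mat2_expand del: oscale.simps)
    apply (intro conjI)
    subgoal
      apply (simp only: inner_der_skew[of y2 z1] inner_der_skew[of x2 y1] inner_der_skew[of x2 z1]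
        inner_der_cubic_swap[of x1 z2 y1] inner_der_cubic_swap[of x1 y2 z1] inner_der_cubic_swap[of y1 x2 z1] assms)
      by (simp add: s oscale_numeral O.scale_left_distrib O.scale_left_diff_distrib del: oscale.simps)
    subgoal
      apply (simp only: inner_der_skew[of y1 z2] inner_der_skew[of x1 y2] inner_der_skew[of x1 z2]
        inner_der_cubic_swap[of x2 z1 y2] inner_der_cubic_swap[of x2 y1 z2] inner_der_cubic_swap[of y2 x1 z2] assms)
      by (simp add: s oscale_numeral O.scale_left_distrib O.scale_left_diff_distrib del: oscale.simps)
    done
qed

lemma g3_jacobi_even_even:
  assumes "D \<in> octonion_der" "E \<in> octonion_der" "F \<in> octonion_der"
  shows "g3_br (D, S, 0, 0) (g3_br (E, T, 0, 0) (F, U, 0, 0)) =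
    g3_br (g3_br (D, S, 0, 0) (E, T, 0, 0)) (F, U, 0, 0)
    + g3_br (E, T, 0, 0) (g3_br (D, S, 0, 0) (F, U, 0, 0))"
  using assms
  apply (simp add: g3_br_even_even octonion_der_commutator del: g3_br.simps)
  apply (simp add: fun_eq_iff octonion_derD mat2_expand del: split_paired_All)
  apply (simp add: algebra_simps)
  done

lemma g3_jacobi_even_odd:
  assumes "D \<in> octonion_der" "E \<in> octonion_der" "S $ 2 $ 2 = - (S $ 1 $ 1)" "T $ 2 $ 2 = - (T $ 1 $ 1)"
  shows "g3_br (D, S, 0, 0) (g3_br (E, T, 0, 0) (0, 0, z1, z2)) =
    g3_br (g3_br (D, S, 0, 0) (E, T, 0, 0)) (0, 0, z1, z2)
    + g3_br (E, T, 0, 0) (g3_br (D, S, 0, 0) (0, 0, z1, z2))"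
  using assms
  apply (simp add: g3_br_parts octonion_der_commutator del: g3_br.simps)
  apply (simp add: octonion_derD mat2_expand O.scale_left_distrib O.scale_right_distrib O.scale_left_diff_distrib
    O.scale_right_diff_distrib oscale_numeral del: oscale.simps)
  apply (simp add: algebra_simps del: oscale.simps)
  done

lemma g3_jacobi_even_odd_even:
  assumes "D \<in> octonion_der" "E \<in> octonion_der" "S $ 2 $ 2 = - (S $ 1 $ 1)" "T $ 2 $ 2 = - (T $ 1 $ 1)"
  shows "g3_br (D, S, 0, 0) (g3_br (0, 0, z1, z2) (E, T, 0, 0)) =
    g3_br (g3_br (D, S, 0, 0) (0, 0, z1, z2)) (E, T, 0, 0)
    + g3_br (0, 0, z1, z2) (g3_br (D, S, 0, 0) (E, T, 0, 0))"
  using assms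
  apply (simp add: g3_br_parts octonion_der_commutator del: g3_br.simps)
  apply (simp add: octonion_derD mat2_expand O.scale_left_distrib O.scale_right_distrib O.scale_left_diff_distrib
    O.scale_right_diff_distrib oscale_numeral del: oscale.simps)
  apply (simp add: algebra_simps del: oscale.simps)
  done

lemma g3_jacobi_odd_even_even:
  assumes "D \<in> octonion_der" "E \<in> octonion_der" "S $ 2 $ 2 = - (S $ 1 $ 1)" "T $ 2 $ 2 = - (T $ 1 $ 1)"
  shows "g3_br (0, 0, z1, z2) (g3_br (D, S, 0, 0) (E, T, 0, 0)) =
    g3_br (g3_br (0, 0, z1, z2) (D, S, 0, 0)) (E, T, 0, 0)
    + g3_br (D, S, 0, 0) (g3_br (0, 0, z1, z2) (E, T, 0, 0))"
  using assms
  apply (simp add: g3_br_parts octonion_der_commutator del: g3_br.simps)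
  apply (simp add: octonion_derD mat2_expand O.scale_left_distrib O.scale_right_distrib O.scale_left_diff_distrib
    O.scale_right_diff_distrib oscale_numeral del: oscale.simps)
  apply (simp add: algebra_simps del: oscale.simps)
  done

lemma g3_jacobi_odd_odd:
  assumes D: "D \<in> octonion_der" and "S $ 2 $ 2 = - (S $ 1 $ 1)"
  shows "g3_br (D, S, 0, 0) (g3_br (0, 0, y1, y2) (0, 0, z1, z2)) =
    g3_br (g3_br (D, S, 0, 0) (0, 0, y1, y2)) (0, 0, z1, z2)
    + g3_br (0, 0, y1, y2) (g3_br (D, S, 0, 0) (0, 0, z1, z2))"
proof -
  have I: "inner_der u v - inner_der u' v' \<in> octonion_der" for u v u' v'
    by (rule octonion_der_lin(2)) (rule inner_der_in_octonion_der)+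
  show ?thesis
  using assms
  apply (simp add: g3_br_odd_odd g3_br_even_even[OF D I] g3_br_even_odd[OF D] del: g3_br.simps)
  apply (simp add: fun_eq_iff octonion_derD octonion_der_inner_der inner_der_lin inner_der_scale
     mat2_expand octonion_der_otrace_mult omul_lin omul_scale_left omul_scale_right otrace_lin del: oscale.simps split_paired_All)
  apply (simp add: algebra_simps del: oscale.simps split_paired_All)
  done
qed
lemma g3_jacobi_odd_even_odd:
  assumes D: "D \<in> octonion_der" and "S $ 2 $ 2 = - (S $ 1 $ 1)"
  shows "g3_br (0, 0, y1, y2) (g3_br (D, S, 0, 0) (0, 0, z1, z2)) =
    g3_br (g3_br (0, 0, y1, y2) (D, S, 0, 0)) (0, 0, z1, z2)
    + g3_br (D, S, 0, 0) (g3_br (0, 0, y1, y2) (0, 0, z1, z2))"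
proof -
  have I: "inner_der u v - inner_der u' v' \<in> octonion_der" for u v u' v'
    by (rule octonion_der_lin(2)) (rule inner_der_in_octonion_der)+
  show ?thesis
  using assms
  apply (simp add: g3_br_odd_odd g3_br_even_even[OF D I] g3_br_even_odd[OF D] g3_br_odd_even[OF D] g3_br_even_even[OF I D] del: g3_br.simps)
  apply (simp add: fun_eq_iff octonion_derD octonion_der_inner_der inner_der_lin inner_der_scale
     mat2_expand octonion_der_otrace_mult omul_lin omul_scale_left omul_scale_right otrace_lin del: oscale.simps split_paired_All)
  apply (simp add: algebra_simps del: oscale.simps split_paired_All)
  done
qed
lemma g3_jacobi_odd_odd_even:
  assumes D: "D \<in> octonion_der" and "S $ 2 $ 2 = - (S $ 1 $ 1)"
  shows "g3_br (0, 0, y1, y2) (g3_br (0, 0, z1, z2) (D, S, 0, 0)) =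
    g3_br (g3_br (0, 0, y1, y2) (0, 0, z1, z2)) (D, S, 0, 0)
    - g3_br (0, 0, z1, z2) (g3_br (0, 0, y1, y2) (D, S, 0, 0))"
proof -
  have I: "inner_der u v - inner_der u' v' \<in> octonion_der" for u v u' v'
    by (rule octonion_der_lin(2)) (rule inner_der_in_octonion_der)+
  show ?thesis
  using assms
  apply (simp add: g3_br_odd_odd g3_br_even_even[OF D I] g3_br_even_odd[OF D] g3_br_odd_even[OF D] g3_br_even_even[OF I D] del: g3_br.simps)
  apply (simp add: fun_eq_iff octonion_derD octonion_der_inner_der inner_der_lin inner_der_scale
     mat2_expand octonion_der_otrace_mult omul_lin omul_scale_left omul_scale_right otrace_lin del: oscale.simps split_paired_All)
  apply (simp add: algebra_simps inner_der_skew[of z1] inner_der_skew[of z2] otrace_comm[of z1] otrace_comm[of z2]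
     octonion_der_otrace_mult[OF D] zero_prod_def[symmetric] del: oscale.simps split_paired_All)
  done
qed

lemma g3_jacobi:
  "\<forall>x\<in>g3_part p. \<forall>y\<in>g3_part q. \<forall>z\<in>g3_part r.
   g3_br x (g3_br y z) = g3_br (g3_br x y) z + g3_scale (parity_sign p q) (g3_br y (g3_br x z))"
  by (cases p; cases q; cases r;
      simp only: g3_part_ball parity_sign_def simp_thms if_True if_False
        V.scale_one V.scale_minus_left add_uminus_conv_diff;
      intro allI impI;
      rule g3_jacobi_odd g3_jacobi_even_even g3_jacobi_even_odd g3_jacobi_odd_odd
        g3_jacobi_even_odd_even g3_jacobi_odd_even_even g3_jacobi_odd_even_odd g3_jacobi_odd_odd_even;
      assumption)

lemma g3_br_add_left:
  assumes "D \<in> octonion_der" "E \<in> octonion_der" "F \<in> octonion_der"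
  shows "g3_br ((D, S, x1, x2) + (E, T, y1, y2)) (F, U, z1, z2)
    = g3_br (D, S, x1, x2) (F, U, z1, z2) + g3_br (E, T, y1, y2) (F, U, z1, z2)"
  using assms
  apply (simp add: octonion_derD inner_der_lin fun_eq_iff del: oscale.simps split_paired_All)
  apply (simp add: mat2_expand g3_lin  del: oscale.simps split_paired_All)
  apply (simp add: algebra_simps del: oscale.simps split_paired_All)
  done

lemma g3_br_add_right:
  assumes "D \<in> octonion_der" "E \<in> octonion_der" "F \<in> octonion_der"
  shows "g3_br (F, U, z1, z2) ((D, S, x1, x2) + (E, T, y1, y2))
    = g3_br (F, U, z1, z2) (D, S, x1, x2) + g3_br (F, U, z1, z2) (E, T, y1, y2)"
  using assms
  apply (simp add: octonion_derD inner_der_lin fun_eq_iff del: oscale.simps split_paired_All)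
  apply (simp add: mat2_expand g3_lin  del: oscale.simps split_paired_All)
  apply (simp add: algebra_simps del: oscale.simps split_paired_All)
  done

lemma g3_br_scale:
  assumes "D \<in> octonion_der" "E \<in> octonion_der"
  shows "g3_br (g3_scale c (D, S, x1, x2)) (E, T, y1, y2) = g3_scale c (g3_br (D, S, x1, x2) (E, T, y1, y2))"
    "g3_br (D, S, x1, x2) (g3_scale c (E, T, y1, y2)) = g3_scale c (g3_br (D, S, x1, x2) (E, T, y1, y2))"
  using assms
   apply (simp_all add: octonion_derD fun_eq_iff g3_lin del: oscale.simps split_paired_All)
   apply (simp_all add: mat2_expand g3_lin  del: oscale.simps split_paired_All)
   apply (simp_all add: algebra_simps del: oscale.simps split_paired_All)
  done

global_interpretation G3: lie_superalgebra g3_scale g3_part g3_br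
proof -
  interpret V: vector_space g3_scale by (rule g3_scale_vector_space)
  show "lie_superalgebra g3_scale g3_part g3_br"
  proof (unfold_locales, unfold g3_total)
    show "V.subspace (g3_part p)" for p by (rule g3_subspace)
    show "g3_part False \<inter> g3_part True = {0}"
      by (auto simp: g3_part_iff zero_g3 elim!: g3_odd_cases simp: octonion_der_lin trace0_2)
    show "x \<in> g3_part p \<Longrightarrow> y \<in> g3_part q \<Longrightarrow> g3_br x y \<in> g3_part (p \<noteq> q)" for x y p q
      using g3_br_part by blast
    show "x \<in> g3_part p \<Longrightarrow> y \<in> g3_part q \<Longrightarrow> g3_br x y = - g3_scale (parity_sign p q) (g3_br y x)" for x y p q
      using g3_br_skew by blast
    show "x \<in> g3_part p \<Longrightarrow> y \<in> g3_part q \<Longrightarrow> z \<in> g3_part r \<Longrightarrow>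
        g3_br x (g3_br y z) = g3_br (g3_br x y) z + g3_scale (parity_sign p q) (g3_br y (g3_br x z))" for x y z p q r
      using g3_jacobi by blast
  qed (clarify; rule g3_br_add_left g3_br_add_right g3_br_scale; assumption)+
qed

subsection \<open>The root system\<close>

definition cartan_der :: "complex^3 \<Rightarrow> oct \<Rightarrow> oct" where
  "cartan_der a = fst (cartan_elt a 0)"

lemma cartan_der_apply: "cartan_der a (s, v, w, t) = (0, \<chi> i. a $ i * v $ i, \<chi> i. - (a $ i * w $ i), 0)"
  by (simp add: cartan_der_def cartan_elt_def)

lemma cartan_elt_eq: "cartan_elt a b = (cartan_der a, vector [vector [b, 0], vector [0, - b]], 0, 0)"
  by (simp add: cartan_der_def cartan_elt_def)

lemma cartan_der_octonion_der:
  assumes "a $ 1 + a $ 2 + a $ 3 = 0"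
  shows "cartan_der a \<in> octonion_der"
proof -
  have a: "a $ 3 = - a $ 1 - a $ 2" using assms by (simp add: algebra_simps eq_neg_iff_add_eq_0)
  show ?thesis unfolding octonion_der_def
    by (simp add: cartan_der_apply oct_expand a algebra_simps)
qed

lemma g3_cartan_iff: "t \<in> g3_cartan \<longleftrightarrow> (\<exists>a b. a $ 1 + a $ 2 + a $ 3 = 0 \<and> t = cartan_elt a b)"
  by (auto simp: g3_cartan_def)

lemma g3_cartan_ball:
  "(\<forall>t\<in>g3_cartan. Q t) \<longleftrightarrow> (\<forall>a b. a $ 1 + a $ 2 + a $ 3 = 0 \<longrightarrow> Q (cartan_elt a b))"
  unfolding g3_cartan_def by blast

lemma g3_total_iff: "(D, S, x1, x2) \<in> graded_carrier g3_part \<longleftrightarrow>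
   D \<in> octonion_der \<and> trace S = 0 \<and> otrace x1 = 0 \<and> otrace x2 = 0"
  unfolding g3_total by blast

lemma g3_weight_elt:
  assumes "a $ 1 + a $ 2 + a $ 3 = 0"
  shows "eps i (cartan_elt a b) = a $ i" "half_gamma (cartan_elt a b) = b"
  using assms
  by (auto simp: eps_def half_gamma_def g3_cartan_iff cartan_elt_eq cartan_der_apply)

lemma g3_gamma_elt:
  assumes "a $ 1 + a $ 2 + a $ 3 = 0"
  shows "gamma (cartan_elt a b) = b + b"
  using assms by (simp add: gamma_def g3_weight_elt)

lemma g3_weight_outside: "t \<notin> g3_cartan \<Longrightarrow> eps i t = 0" "t \<notin> g3_cartan \<Longrightarrow> half_gamma t = 0"
  by (auto simp: eps_def half_gamma_def)

lemma g3_cartan_elt_lin: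
  "cartan_elt a b + cartan_elt a' b' = cartan_elt (a + a') (b + b')"
  "g3_scale c (cartan_elt a b) = cartan_elt (\<chi> i. c * a $ i) (c * b)"
  by (simp_all add: cartan_elt_eq fun_eq_iff cartan_der_apply mat2_expand zero_prod_def vec_eq_iff algebra_simps)

lemma g3_dual_eqI:
  assumes "\<alpha> \<in> G3.dual g3_cartan" "\<beta> \<in> G3.dual g3_cartan"
    "\<And>a b. a $ 1 + a $ 2 + a $ 3 = 0 \<Longrightarrow> \<alpha> (cartan_elt a b) = \<beta> (cartan_elt a b)"
  shows "\<alpha> = \<beta>"
proof
  fix t
  show "\<alpha> t = \<beta> t"
  proof (cases "t \<in> g3_cartan")
    case True
    then show ?thesis unfolding g3_cartan_iff using assms(3) by blast
  next
    case False
    then show ?thesis using assms(1,2) unfolding G3.dual_def mem_Collect_eq by metis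
  qed
qed

lemma g3_dual_basic: "eps i \<in> G3.dual g3_cartan" "half_gamma \<in> G3.dual g3_cartan" "0 \<in> G3.dual g3_cartan"
  "gamma \<in> G3.dual g3_cartan"
proof -
  have s: "(\<chi> i. c * a $ i) $ 1 + (\<chi> i. c * a $ i) $ 2 + (\<chi> i. c * a $ i) $ 3 = 0"
    if "a $ 1 + a $ 2 + a $ 3 = 0" for c :: complex and a :: "complex^3"
    using that by (simp flip: distrib_left)
  have p: "(a + a') $ 1 + (a + a') $ 2 + (a + a') $ 3 = 0"
    if "a $ 1 + a $ 2 + a $ 3 = 0" "a' $ 1 + a' $ 2 + a' $ 3 = 0" for a a' :: "complex^3"
    using that by (simp add: algebra_simps) (metis add.assoc add.left_commute add_0)
  show "eps i \<in> G3.dual g3_cartan" "half_gamma \<in> G3.dual g3_cartan" "0 \<in> G3.dual g3_cartan"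
    "gamma \<in> G3.dual g3_cartan"
    unfolding G3.dual_def g3_cartan_ball
    by (simp_all add: gamma_def g3_weight_outside g3_cartan_elt_lin g3_weight_elt(1)[OF s] g3_weight_elt(2)[OF s]
        g3_weight_elt(1)[OF p] g3_weight_elt(2)[OF p] g3_weight_elt
        del: g3_scale.simps split_paired_All vector_add_component)
       (simp_all add: vec_eq_iff algebra_simps)
qed

lemma g3_dual_lin:
  "\<alpha> \<in> G3.dual g3_cartan \<Longrightarrow> \<beta> \<in> G3.dual g3_cartan \<Longrightarrow> \<alpha> + \<beta> \<in> G3.dual g3_cartan"
  "\<alpha> \<in> G3.dual g3_cartan \<Longrightarrow> \<beta> \<in> G3.dual g3_cartan \<Longrightarrow> \<alpha> - \<beta> \<in> G3.dual g3_cartan"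
  "\<alpha> \<in> G3.dual g3_cartan \<Longrightarrow> - \<alpha> \<in> G3.dual g3_cartan"
  unfolding G3.dual_def by (simp_all add: algebra_simps)

lemma g3_br_cartan:
  assumes "D \<in> octonion_der" "a $ 1 + a $ 2 + a $ 3 = 0"
  shows "g3_br (cartan_elt a b) (D, S, x1, x2) =
    ((cartan_der a \<circ> D) - (D \<circ> cartan_der a), \<chi> i j. (if i = j then 0 else if i = 1 then 2 * b else - 2 * b) * S $ i $ j,
     cartan_der a x1 + oscale b x1, cartan_der a x2 - oscale b x2)"
  using cartan_der_octonion_der[OF assms(2)]
  by (simp add: cartan_elt_eq octonion_derD(4)[OF assms(1)] oct_zero_scale del: oscale.simps)
     (simp add: mat2_expand O.scale_minus_left)

lemma g3_root_space_iff:
  assumes "\<alpha> \<in> G3.dual g3_cartan"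
  shows "(D, S, x1, x2) \<in> G3.root_space g3_cartan \<alpha> \<longleftrightarrow>
    D \<in> octonion_der \<and> trace S = 0 \<and> otrace x1 = 0 \<and> otrace x2 = 0 \<and>
    (\<forall>a b. a $ 1 + a $ 2 + a $ 3 = 0 \<longrightarrow> (let k = \<alpha> (cartan_elt a b) in
      (\<forall>z. cartan_der a (D z) - D (cartan_der a z) = oscale k (D z)) \<and>
      (S $ 1 $ 1 = 0 \<or> k = 0) \<and> (S $ 1 $ 2 = 0 \<or> 2 * b = k) \<and> (S $ 2 $ 1 = 0 \<or> - (2 * b) = k) \<and> cartan_der a x1 + oscale b x1 = oscale k x1 \<and> cartan_der a x2 - oscale b x2 = oscale k x2))"
proof -
  have "trace S = 0 \<Longrightarrow> S $ 2 $ 2 = - S $ 1 $ 1" using trace0_2 by blast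
  then show ?thesis
    unfolding G3.root_space_def mem_Collect_eq g3_cartan_ball g3_total_iff Let_def
    by (cases "D \<in> octonion_der \<and> trace S = 0")
       (simp_all add: g3_br_cartan fun_eq_iff vec_eq_iff forall_2 conj_ac disj_commute cong: conj_cong
         del: g3_br.simps split_paired_All)
qed

abbreviation "oct_h \<equiv> ((1, 0, 0, -1) :: oct)"
abbreviation "oct_up i \<equiv> ((0, axis i 1, 0, 0) :: oct)"
abbreviation "oct_low i \<equiv> ((0, 0, axis i 1, 0) :: oct)"

lemma cartan_der_basis:
  "cartan_der a oct_h = oscale 0 oct_h" "cartan_der a (oct_up i) = oscale (a $ i) (oct_up i)" 
  "cartan_der a (oct_low i) = oscale (- a $ i) (oct_low i)"
  by (simp_all add: cartan_der_apply vec_eq_iff axis_def zero_prod_def)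

lemma root_vector_odd:
  assumes "\<alpha> \<in> G3.dual g3_cartan" "otrace x = 0"
    "\<And>a b. a $ 1 + a $ 2 + a $ 3 = 0 \<Longrightarrow> cartan_der a x = oscale (\<alpha> (cartan_elt a b)) x"
  shows "(0, 0, x, 0) \<in> G3.root_space g3_cartan (\<alpha> + half_gamma)"
    "(0, 0, 0, x) \<in> G3.root_space g3_cartan (\<alpha> - half_gamma)"
proof -
  have 0: "cartan_der a 0 = 0" for a by (simp add: zero_prod_def cartan_der_apply vec_eq_iff)
  show "(0, 0, x, 0) \<in> G3.root_space g3_cartan (\<alpha> + half_gamma)"
    "(0, 0, 0, x) \<in> G3.root_space g3_cartan (\<alpha> - half_gamma)"
    using assms(2) g3_dual_lin(1,2)[OF assms(1) g3_dual_basic(2)]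
    by (simp_all add: g3_root_space_iff octonion_der_lin trace0_2 oct_zero_scale Let_def assms(3) g3_weight_elt 0
      O.scale_left_distrib O.scale_left_diff_distrib del: oscale.simps split_paired_All)
qed

lemma root_vector_inner_der:
  assumes "\<alpha> \<in> G3.dual g3_cartan" "\<beta> \<in> G3.dual g3_cartan"
    "\<And>a b. a $ 1 + a $ 2 + a $ 3 = 0 \<Longrightarrow> cartan_der a x = oscale (\<alpha> (cartan_elt a b)) x"
    "\<And>a b. a $ 1 + a $ 2 + a $ 3 = 0 \<Longrightarrow> cartan_der a y = oscale (\<beta> (cartan_elt a b)) y"
  shows "(inner_der x y, 0, 0, 0) \<in> G3.root_space g3_cartan (\<alpha> + \<beta>)"
proof -
  have 0: "cartan_der a 0 = 0" for a by (simp add: zero_prod_def cartan_der_apply vec_eq_iff)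
  have "cartan_der a (inner_der x y z) - inner_der x y (cartan_der a z) =
    oscale (\<alpha> (cartan_elt a b) + \<beta> (cartan_elt a b)) (inner_der x y z)"
    if a: "a $ 1 + a $ 2 + a $ 3 = 0" for a b z
    by (simp add: octonion_der_inner_der[OF cartan_der_octonion_der[OF a]] assms(3)[OF a, of b] assms(4)[OF a, of b]
       inner_der_scale O.scale_left_distrib del: oscale.simps)
  then show ?thesis using g3_dual_lin(1)[OF assms(1,2)]
    by (simp add: g3_root_space_iff inner_der_in_octonion_der trace0_2 oct_zero_scale Let_def 0 del: oscale.simps split_paired_All)
qed

lemma in_rootsI: "x \<in> G3.root_space g3_cartan \<alpha> \<Longrightarrow> x \<noteq> 0 \<Longrightarrow> \<alpha> \<in> G3.dual g3_cartan \<Longrightarrow> \<alpha> \<noteq> 0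
  \<Longrightarrow> \<alpha> \<in> G3.roots g3_cartan"
  unfolding G3.roots_def by blast

lemma test_nonzero: "\<alpha> (cartan_elt (vector [1, 2, - 3]) 10) \<noteq> 0 \<Longrightarrow> \<alpha> \<noteq> 0"
  by auto

lemma test_eps: "eps i (cartan_elt (vector [1, 2, - 3]) 10) = vector [1, 2, - 3] $ i"
  "half_gamma (cartan_elt (vector [1, 2, - 3]) 10) = 10"
  by (simp_all add: g3_weight_elt)

lemma g3_roots_nonzero:
  "i \<noteq> j \<Longrightarrow> eps i - eps j \<noteq> 0" "eps i \<noteq> 0" "- eps i \<noteq> 0"
  "gamma \<noteq> 0" "- gamma \<noteq> 0"
  "half_gamma \<noteq> 0" "- half_gamma \<noteq> 0"
  "eps i + half_gamma \<noteq> 0" "eps i - half_gamma \<noteq> 0" "- eps i + half_gamma \<noteq> 0" "- eps i - half_gamma \<noteq> 0"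
  by (rule test_nonzero, (use exhaust_3[of i] exhaust_3[of j] in \<open>auto simp: test_eps gamma_def\<close>)[1])+

lemma basis_weights:
  assumes "a $ 1 + a $ 2 + a $ 3 = 0"
  shows "cartan_der a oct_h = oscale ((0 :: g3 \<Rightarrow> complex) (cartan_elt a b)) oct_h"
   "cartan_der a (oct_up i) = oscale (eps i (cartan_elt a b)) (oct_up i)"
   "cartan_der a (oct_low i) = oscale ((- eps i) (cartan_elt a b)) (oct_low i)"
  unfolding cartan_der_basis using assms by (simp_all add: g3_weight_elt)

lemma root_vector_eps_diff: "(inner_der (oct_up i) (oct_low j), 0, 0, 0) \<in> G3.root_space g3_cartan (eps i - eps j)"
  using root_vector_inner_der[OF g3_dual_basic(1)[of i] g3_dual_lin(3)[OF g3_dual_basic(1)[of j]]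
     basis_weights(2) basis_weights(3)]
  by (simp only: add_uminus_conv_diff)

lemma root_vector_eps: "(inner_der oct_h (oct_up i), 0, 0, 0) \<in> G3.root_space g3_cartan (eps i)"
  using root_vector_inner_der[OF g3_dual_basic(3) g3_dual_basic(1)[of i] basis_weights(1) basis_weights(2)]
  by (simp only: add_0)

lemma root_vector_minus_eps: "(inner_der oct_h (oct_low i), 0, 0, 0) \<in> G3.root_space g3_cartan (- eps i)"
  using root_vector_inner_der[OF g3_dual_basic(3) g3_dual_lin(3)[OF g3_dual_basic(1)[of i]] basis_weights(1) basis_weights(3)]
  by (simp only: add_0)

lemma inner_der_nonzero:
  "i \<noteq> j \<Longrightarrow> inner_der (oct_up i) (oct_low j) \<noteq> 0" "inner_der oct_h (oct_up i) \<noteq> 0" "inner_der oct_h (oct_low i) \<noteq> 0"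
proof -
  have "i \<noteq> j \<Longrightarrow> inner_der (oct_up i) (oct_low j) (oct_up j) \<noteq> 0"
    using exhaust_3[of i] exhaust_3[of j]
    by (auto simp: inner_der_def oct_expand axis_def)
  then show "i \<noteq> j \<Longrightarrow> inner_der (oct_up i) (oct_low j) \<noteq> 0" by auto
  have "inner_der oct_h (oct_up i) oct_h \<noteq> 0" "inner_der oct_h (oct_low i) oct_h \<noteq> 0"
    using exhaust_3[of i]
    by (auto simp: inner_der_def oct_expand axis_def)
  then show "inner_der oct_h (oct_up i) \<noteq> 0" "inner_der oct_h (oct_low i) \<noteq> 0" by auto
qed

lemma root_vector_gamma:
  "(0, vector [vector [0, 1], vector [0, 0]], 0, 0) \<in> G3.root_space g3_cartan gamma"
  "(0, vector [vector [0, 0], vector [1, 0]], 0, 0) \<in> G3.root_space g3_cartan (- gamma)"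
proof -
  have 0: "cartan_der a 0 = 0" for a by (simp add: zero_prod_def cartan_der_apply vec_eq_iff)
  note d = g3_dual_basic(4)
  show "(0, vector [vector [0, 1], vector [0, 0]], 0, 0) \<in> G3.root_space g3_cartan gamma"
  "(0, vector [vector [0, 0], vector [1, 0]], 0, 0) \<in> G3.root_space g3_cartan (- gamma)"
    by (simp_all add: g3_root_space_iff[OF d] g3_root_space_iff[OF g3_dual_lin(3)[OF d]]
      octonion_der_lin trace0_2 oct_zero_scale Let_def 0 g3_weight_elt vector_2 g3_gamma_elt del: oscale.simps split_paired_All)
qed

lemma g3_roots_superset: "g3_even_roots \<union> g3_odd_roots \<subseteq> G3.roots g3_cartan"
proof -
  note d = g3_dual_basic g3_dual_lin
  note o = root_vector_odd[OF g3_dual_basic(3) _ basis_weights(1), simplified otrace.simps add_0 diff_0]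
    root_vector_odd[OF g3_dual_basic(1) _ basis_weights(2), simplified otrace.simps]
    root_vector_odd[OF g3_dual_lin(3)[OF g3_dual_basic(1)] _ basis_weights(3), simplified otrace.simps]
  have z: "oct_up i \<noteq> 0" "oct_low i \<noteq> 0" "oct_h \<noteq> 0" for i
    by (auto simp: zero_prod_def)
  have g: "(vector [vector [0, 1], vector [0, 0]] :: complex^2^2) \<noteq> 0"
    "(vector [vector [0, 0], vector [1, 0]] :: complex^2^2) \<noteq> 0"
    by (auto simp: vec_eq_iff forall_2)
  have nz: "D \<noteq> 0 \<Longrightarrow> (D, S, x1, x2) \<noteq> (0 :: g3)" "S \<noteq> 0 \<Longrightarrow> (D, S, x1, x2) \<noteq> (0 :: g3)"
    "x1 \<noteq> 0 \<Longrightarrow> (D, S, x1, x2) \<noteq> (0 :: g3)" "x2 \<noteq> 0 \<Longrightarrow> (D, S, x1, x2) \<noteq> (0 :: g3)" for D S x1 x2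
    by (auto simp: zero_g3)
  have e: "i \<noteq> j \<Longrightarrow> eps i - eps j \<in> G3.roots g3_cartan" "eps i \<in> G3.roots g3_cartan"
    "- eps i \<in> G3.roots g3_cartan" for i j
    by (rule in_rootsI[OF root_vector_eps_diff nz(1)] in_rootsI[OF root_vector_eps nz(1)]
        in_rootsI[OF root_vector_minus_eps nz(1)]; intro inner_der_nonzero d g3_roots_nonzero; assumption?)+
  have g: "gamma \<in> G3.roots g3_cartan" "- gamma \<in> G3.roots g3_cartan"
    by (rule in_rootsI[OF root_vector_gamma(1) nz(2)[OF g(1)]] in_rootsI[OF root_vector_gamma(2) nz(2)[OF g(2)]];
      intro d g3_roots_nonzero)+
  have o0: "half_gamma \<in> G3.roots g3_cartan" "- half_gamma \<in> G3.roots g3_cartan"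
    by (rule in_rootsI[OF o(1) nz(3)[OF z(3)]] in_rootsI[OF o(2) nz(4)[OF z(3)]]; (intro d g3_roots_nonzero | simp))+
  have o1: "eps i + half_gamma \<in> G3.roots g3_cartan" "eps i - half_gamma \<in> G3.roots g3_cartan"
     "- eps i + half_gamma \<in> G3.roots g3_cartan" "- eps i - half_gamma \<in> G3.roots g3_cartan" for i
    by (rule in_rootsI[OF o(3) nz(3)[OF z(1)]] in_rootsI[OF o(4) nz(4)[OF z(1)]]
      in_rootsI[OF o(5) nz(3)[OF z(2)]] in_rootsI[OF o(6) nz(4)[OF z(2)]]; (intro d g3_roots_nonzero | simp))+
  show ?thesis
    unfolding g3_even_roots_def g3_odd_roots_def
  proof (intro Un_least UN_least)
    show "{eps i - eps j |i j. i \<noteq> j} \<subseteq> G3.roots g3_cartan"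
      by (clarify, rule e(1))
  qed (use e(2,3) g o0 o1 in \<open>simp_all only: insert_subset empty_subsetI simp_thms\<close>)
qed

lemma oct_expansion: "z = oscale ((fst z + snd (snd (snd z))) / 2) (1, 0, 0, 1)
    + oscale ((fst z - snd (snd (snd z))) / 2) oct_h
    + (\<Sum>i\<in>UNIV. oscale (fst (snd z) $ i) (oct_up i)) + (\<Sum>i\<in>UNIV. oscale (fst (snd (snd z)) $ i) (oct_low i))"
  by (cases z) (simp add: sum_3 vec_eq_iff forall_3 axis_def field_simps)

lemma octonion_der_eqI_0:
  assumes D: "D \<in> octonion_der" and "D oct_h = 0" "\<And>i. D (oct_up i) = 0" "\<And>i. D (oct_low i) = 0"
  shows "D = 0"
proof
  fix z
  show "D z = 0 z"
    by (subst oct_expansion)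
       (simp only: sum_3 octonion_derD[OF D] octonion_der_one[OF D] assms(2-) O.scale_zero_right add_0 zero_fun_apply)
qed

lemma weight_cases:
  assumes "u \<noteq> 0" "otrace u = 0"
    and w: "\<And>a b. a $ 1 + a $ 2 + a $ 3 = 0 \<Longrightarrow> cartan_der a u = oscale (\<mu> (cartan_elt a b)) u"
    and m: "\<mu> \<in> G3.dual g3_cartan"
  shows "\<mu> = 0 \<or> (\<exists>i. \<mu> = eps i \<and> fst (snd u) $ i \<noteq> 0) \<or> (\<exists>i. \<mu> = - eps i \<and> fst (snd (snd u)) $ i \<noteq> 0)"
proof -
  obtain p v w' q where u: "u = (p, v, w', q)" by (cases u)
  have eq: "\<mu> (cartan_elt a b) * p = 0" "a $ i * v $ i = \<mu> (cartan_elt a b) * v $ i"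
    "- a $ i * w' $ i = \<mu> (cartan_elt a b) * w' $ i" if "a $ 1 + a $ 2 + a $ 3 = 0" for a b i
    using w[OF that, of b] by (auto simp: u cartan_der_apply vec_eq_iff)
  have "p \<noteq> 0 \<or> (\<exists>i. v $ i \<noteq> 0) \<or> (\<exists>i. w' $ i \<noteq> 0)"
    using assms(1,2) by (auto simp: u zero_prod_def vec_eq_iff)
  then consider "p \<noteq> 0" | i where "v $ i \<noteq> 0" | i where "w' $ i \<noteq> 0" by blast
  then show ?thesis
  proof cases
    case 1
    then have "\<mu> = 0" using eq(1) by (intro g3_dual_eqI m g3_dual_basic) auto
    then show ?thesis by simp
  next
    case (2 i)
    then have "\<mu> = eps i" using eq(2)[of _ i] by (intro g3_dual_eqI m g3_dual_basic) (simp add: g3_weight_elt)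
    then show ?thesis using 2 u by auto
  next
    case (3 i)
    then have "\<mu> = - eps i" using eq(3)[of _ i]
      by (intro g3_dual_eqI m g3_dual_basic g3_dual_lin) (metis g3_weight_elt(1) mult_cancel_right uminus_apply)
    then show ?thesis using 3 u by auto
  qed
qed

lemma eps_sum: "eps 1 + eps 2 + eps 3 = 0"
  by (intro g3_dual_eqI g3_dual_lin g3_dual_basic) (simp add: g3_weight_elt)

lemma eps_add: assumes "i \<noteq> j" shows "\<exists>k. eps i + eps j = - eps k"
proof -
  have "eps 1 + eps 2 = - eps 3" "eps 1 + eps 3 = - eps 2" "eps 2 + eps 3 = - eps 1"
    using eps_sum by (simp_all add: eq_neg_iff_add_eq_0 add_ac)
  then show ?thesis using assms exhaust_3[of i] exhaust_3[of j] by (metis add.commute)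
qed

lemma octonion_der_self_pairing: "D \<in> octonion_der \<Longrightarrow> otrace (D x \<odot> x) = 0"
  using octonion_der_otrace_mult[of D x x] otrace_comm[of x "D x"]
  by (simp add: eq_neg_iff_add_eq_0)

lemma g3_even_rootsI:
  "i \<noteq> j \<Longrightarrow> eps i - eps j \<in> g3_even_roots" "eps i \<in> g3_even_roots" "- eps i \<in> g3_even_roots"
  "gamma \<in> g3_even_roots" "- gamma \<in> g3_even_roots"
  unfolding g3_even_roots_def by blast+

lemma g3_odd_rootsI:
  "half_gamma \<in> g3_odd_roots" "- half_gamma \<in> g3_odd_roots"
  "eps i + half_gamma \<in> g3_odd_roots" "eps i - half_gamma \<in> g3_odd_roots"
  "- eps i + half_gamma \<in> g3_odd_roots" "- eps i - half_gamma \<in> g3_odd_roots"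
  unfolding g3_odd_roots_def by blast+

lemma g3_roots_subset: "G3.roots g3_cartan \<subseteq> g3_even_roots \<union> g3_odd_roots"
proof
  fix \<alpha> assume "\<alpha> \<in> G3.roots g3_cartan"
  then have al: "\<alpha> \<in> G3.dual g3_cartan" and nz: "\<alpha> \<noteq> 0" and "G3.root_space g3_cartan \<alpha> \<noteq> {0}"
    by (auto simp: G3.roots_def)
  moreover have "0 \<in> G3.root_space g3_cartan \<alpha>"
  proof -
    have 0: "cartan_der a 0 = 0" for a by (simp add: zero_prod_def cartan_der_apply vec_eq_iff)
    show ?thesis unfolding zero_g3 g3_root_space_iff[OF al]
      by (simp add: octonion_der_lin trace0_2 0 oct_zero_scale Let_def del: oscale.simps split_paired_All)
  qed
  ultimately obtain D S x1 x2 where x: "(D, S, x1, x2) \<in> G3.root_space g3_cartan \<alpha>" "(D, S, x1, x2) \<noteq> 0"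
    by (metis (no_types, lifting) empty_iff insertI1 prod_cases4 subsetI subset_singleton_iff)
  note r = x(1)[unfolded g3_root_space_iff[OF al] Let_def]
  have S22: "S $ 2 $ 2 = - (S $ 1 $ 1)" using r trace0_2 by blast
  have "x1 \<noteq> 0 \<or> x2 \<noteq> 0 \<or> S $ 1 $ 1 \<noteq> 0 \<or> S $ 1 $ 2 \<noteq> 0 \<or> S $ 2 $ 1 \<noteq> 0 \<or> D \<noteq> 0"
    using x(2) S22 by (auto simp: zero_g3 vec_eq_iff forall_2)
  moreover have "D = 0 \<or> D oct_h \<noteq> 0 \<or> (\<exists>i. D (oct_up i) \<noteq> 0) \<or> (\<exists>i. D (oct_low i) \<noteq> 0)"
    using octonion_der_eqI_0 r by metis
  ultimately consider "x1 \<noteq> 0" | "x2 \<noteq> 0" | "S $ 1 $ 1 \<noteq> 0" | "S $ 1 $ 2 \<noteq> 0" | "S $ 2 $ 1 \<noteq> 0"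
    | "D oct_h \<noteq> 0" | i where "D (oct_up i) \<noteq> 0" | i where "D (oct_low i) \<noteq> 0" by blast
  then show "\<alpha> \<in> g3_even_roots \<union> g3_odd_roots"
  proof cases
    case 1
    have "\<alpha> - half_gamma = 0 \<or> (\<exists>i. \<alpha> - half_gamma = eps i \<and> fst (snd x1) $ i \<noteq> 0) \<or> (\<exists>i. \<alpha> - half_gamma = - eps i \<and> fst (snd (snd x1)) $ i \<noteq> 0)"
      using 1 r g3_dual_lin(2)[OF al g3_dual_basic(2)]
      by (intro weight_cases) (auto simp: g3_weight_elt O.scale_left_diff_distrib algebra_simps simp del: oscale.simps split_paired_All)
    then have "\<alpha> = half_gamma \<or> (\<exists>i. \<alpha> = eps i + half_gamma) \<or> (\<exists>i. \<alpha> = - eps i + half_gamma)"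
      by (auto simp only: diff_eq_eq add_0)
    then show ?thesis by (elim disjE exE) (simp_all only: g3_odd_rootsI Un_iff simp_thms)
  next
    case 2
    have "\<alpha> + half_gamma = 0 \<or> (\<exists>i. \<alpha> + half_gamma = eps i \<and> fst (snd x2) $ i \<noteq> 0) \<or> (\<exists>i. \<alpha> + half_gamma = - eps i \<and> fst (snd (snd x2)) $ i \<noteq> 0)"
      using 2 r g3_dual_lin(1)[OF al g3_dual_basic(2)]
      by (intro weight_cases) (auto simp: g3_weight_elt O.scale_left_distrib algebra_simps simp del: oscale.simps split_paired_All)
    then have "\<alpha> = - half_gamma \<or> (\<exists>i. \<alpha> = eps i - half_gamma) \<or> (\<exists>i. \<alpha> = - eps i - half_gamma)"
      by (auto simp only: eq_diff_eq eq_neg_iff_add_eq_0)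
    then show ?thesis by (elim disjE exE) (simp_all only: g3_odd_rootsI Un_iff simp_thms)
  next
    case 3
    then have "\<alpha> = 0" using r by (intro g3_dual_eqI al g3_dual_basic) auto
    then show ?thesis using nz by simp
  next
    case 4
    then have "\<alpha> = gamma" using r
      by (intro g3_dual_eqI al g3_dual_basic g3_dual_lin) (auto simp: g3_gamma_elt g3_weight_elt simp del: split_paired_All)
    then show ?thesis by (simp only: g3_even_rootsI Un_iff simp_thms)
  next
    case 5
    then have "\<alpha> = - gamma" using r
      by (intro g3_dual_eqI al g3_dual_basic g3_dual_lin) (auto simp: g3_gamma_elt g3_weight_elt simp del: split_paired_All)
    then show ?thesis by (simp only: g3_even_rootsI Un_iff simp_thms)
  next
    have D: "D \<in> octonion_der" using r by blast
    have key: "\<alpha> + \<beta> = 0 \<or> (\<exists>i. \<alpha> + \<beta> = eps i \<and> fst (snd (D e)) $ i \<noteq> 0) \<or> (\<exists>i. \<alpha> + \<beta> = - eps i \<and> fst (snd (snd (D e))) $ i \<noteq> 0)"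
      if "D e \<noteq> 0" "\<beta> \<in> G3.dual g3_cartan"
        and e: "\<And>a b. a $ 1 + a $ 2 + a $ 3 = 0 \<Longrightarrow> cartan_der a e = oscale (\<beta> (cartan_elt a b)) e" for e \<beta>
    proof (rule weight_cases)
      show "cartan_der a (D e) = oscale ((\<alpha> + \<beta>) (cartan_elt a b)) (D e)" if a: "a $ 1 + a $ 2 + a $ 3 = 0" for a b
      proof -
        have "cartan_der a (D e) - D (cartan_der a e) = oscale (\<alpha> (cartan_elt a b)) (D e)" using r a by blast
        then show ?thesis
          by (simp add: e[OF a, of b] octonion_derD[OF D] O.scale_left_distrib diff_eq_eq del: oscale.simps)
      qed
    qed (use that al g3_dual_lin octonion_der_otrace[OF D] in auto)
    {
      case 6
      from key[where \<beta> = 0, OF 6 g3_dual_basic(3) basis_weights(1)] nz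
      have "(\<exists>i. \<alpha> = eps i) \<or> (\<exists>i. \<alpha> = - eps i)"
        unfolding add_0_right by blast
      then show ?thesis by (elim disjE exE) (simp_all only: g3_even_rootsI Un_iff simp_thms)
    next
      case (7 j)
      from key[where \<beta> = "eps j", OF 7 g3_dual_basic(1) basis_weights(2)]
      have "\<alpha> = - eps j \<or> (\<exists>i. \<alpha> = eps i - eps j) \<or> (\<exists>i. \<alpha> = - eps i - eps j \<and> fst (snd (snd (D (oct_up j)))) $ i \<noteq> 0)"
        unfolding eq_diff_eq eq_neg_iff_add_eq_0 by blast
      then consider "\<alpha> = - eps j" | i where "\<alpha> = eps i - eps j" | i where "\<alpha> = - eps i - eps j" "fst (snd (snd (D (oct_up j)))) $ i \<noteq> 0"
        by blast
      then show ?thesis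
      proof cases
        case 1
        then show ?thesis by (simp only: g3_even_rootsI Un_iff simp_thms)
      next
        case (2 i)
        then have "i \<noteq> j" using nz by auto
        with 2 show ?thesis by (simp only: g3_even_rootsI Un_iff simp_thms)
      next
        case (3 i)
        have "fst (snd (snd (D (oct_up j)))) $ j = 0"
          using octonion_der_self_pairing[OF D, of "oct_up j"]
          by (cases "D (oct_up j)") (simp add: dot3_def axis_def if_distrib[of "\<lambda>x. _ * x"] if_distrib[of "\<lambda>x. x * _"] cong: if_cong)
        then have "i \<noteq> j" using 3 by auto
        then obtain k where k: "eps i + eps j = - eps k" using eps_add by blast
        have "\<alpha> = - (eps i + eps j)" using 3(1) by simp
        then have "\<alpha> = eps k" unfolding k by simp
        then show ?thesis by (simp only: g3_even_rootsI Un_iff simp_thms)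
      qed
    next
      case (8 j)
      from key[where \<beta> = "- eps j", OF 8 g3_dual_lin(3)[OF g3_dual_basic(1)] basis_weights(3)]
      have "\<alpha> = eps j \<or> (\<exists>i. \<alpha> = eps i + eps j \<and> fst (snd (D (oct_low j))) $ i \<noteq> 0) \<or> (\<exists>i. \<alpha> = - eps i + eps j)"
        unfolding add_uminus_conv_diff diff_eq_eq add_0 by blast
      then consider "\<alpha> = eps j" | i where "\<alpha> = eps i + eps j" "fst (snd (D (oct_low j))) $ i \<noteq> 0" | i where "\<alpha> = - eps i + eps j"
        by blast
      then show ?thesis
      proof cases
        case 1
        then show ?thesis by (simp only: g3_even_rootsI Un_iff simp_thms)
      next
        case (3 i)
        then have "j \<noteq> i" "\<alpha> = eps j - eps i" using nz by auto
        then show ?thesis by (simp only: g3_even_rootsI Un_iff simp_thms)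
      next
        case (2 i)
        have "fst (snd (D (oct_low j))) $ j = 0"
          using octonion_der_self_pairing[OF D, of "oct_low j"]
          by (cases "D (oct_low j)") (simp add: dot3_def axis_def if_distrib[of "\<lambda>x. _ * x"] if_distrib[of "\<lambda>x. x * _"] cong: if_cong)
        then have "i \<noteq> j" using 2 by auto
        then obtain k where "eps i + eps j = - eps k" using eps_add by blast
        then show ?thesis using 2(1) by (simp only: g3_even_rootsI Un_iff simp_thms)
      qed
    }
  qed
qed

theorem g3_roots: "G3.roots g3_cartan = g3_even_roots \<union> g3_odd_roots"
  using g3_roots_superset g3_roots_subset by blast

end

theory Submission
  imports Defs
begin

text \<open>
  Let \<open>N = P - (- P)\<close> be the nilradical of a parabolic set \<open>P\<close> of roots, and suppose that the root
  spaces of \<open>N\<close> commute.  Write \<open>h\<close> for \<open>half_gamma\<close>.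

  The root \<open>h\<close> is odd and \<open>2 h = \<gamma>\<close> is a root; a root vector for \<open>\<plusminus>h\<close> has nonzero square
  (\<open>g3_br_half_gamma\<close>), so neither \<open>h\<close> nor \<open>- h\<close> lies in \<open>N\<close>.  Hence \<open>h\<close> and \<open>- h\<close>, and with them
  \<open>\<gamma>\<close> and \<open>- \<gamma>\<close>, belong to the Levi part \<open>P \<inter> (- P)\<close>, and \<open>N\<close> is stable under
  translation by \<open>\<plusminus>h\<close> inside the root system.  Now take any root in the nonempty set \<open>N\<close>.
  Translating it by \<open>\<plusminus>h\<close>, or writing a long root as \<open>\<epsilon>\<^sub>i - \<epsilon>\<^sub>j = \<epsilon>\<^sub>i + (- \<epsilon>\<^sub>j)\<close>, produces a short root
  \<open>\<plusminus>\<epsilon>\<^sub>i\<close> of \<open>G\<^sub>2\<close> in \<open>N\<close>; and \<open>\<epsilon>\<^sub>i = - \<epsilon>\<^sub>j - \<epsilon>\<^sub>k\<close> then produces a second one of the opposite sign and with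
  a different index.  So \<open>N\<close> contains \<open>\<epsilon>\<^sub>i\<close> and \<open>- \<epsilon>\<^sub>j\<close> with \<open>i \<noteq> j\<close>, and therefore also
  the odd roots \<open>\<epsilon>\<^sub>i + h\<close> and \<open>- \<epsilon>\<^sub>j - h\<close>.  The bracket of their root vectors is a root vector for
  \<open>\<epsilon>\<^sub>i - \<epsilon>\<^sub>j\<close> (\<open>g3_br_odd_roots\<close>), a contradiction.
\<close>

lemma parabolic_uminus: "parabolic \<Delta> P \<Longrightarrow> \<alpha> \<in> \<Delta> \<Longrightarrow> - \<alpha> \<in> \<Delta>"
  unfolding parabolic_def by force

lemma parabolic_add:
  "parabolic \<Delta> P \<Longrightarrow> \<alpha> \<in> P \<Longrightarrow> \<beta> \<in> P \<Longrightarrow> \<alpha> + \<beta> \<in> \<Delta> \<Longrightarrow> \<alpha> + \<beta> \<in> P"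
  unfolding parabolic_def by blast

lemma in_nilradical_iff: "\<alpha> \<in> nilradical P \<longleftrightarrow> \<alpha> \<in> P \<and> - \<alpha> \<notin> P"
  unfolding nilradical_def by force

lemma parabolic_not_nilradical:
  assumes "parabolic \<Delta> P" "\<alpha> \<in> \<Delta>" "\<alpha> \<notin> nilradical P"
  shows "- \<alpha> \<in> P"
  using assms unfolding parabolic_def in_nilradical_iff by force

lemma nilradical_subset: "parabolic \<Delta> P \<Longrightarrow> nilradical P \<subseteq> \<Delta>"
  unfolding parabolic_def nilradical_def by blast

lemma nilradical_nonempty:
  assumes "parabolic \<Delta> P"
  shows "nilradical P \<noteq> {}"
proof -
  obtain \<alpha> where "\<alpha> \<in> \<Delta>" "\<alpha> \<notin> P" using assms unfolding parabolic_def by blast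
  then have "- \<alpha> \<in> nilradical P"
    using parabolic_not_nilradical[OF assms] by (auto simp: in_nilradical_iff)
  then show ?thesis by blast
qed

text \<open>The nilradical is an ideal of the parabolic set: otherwise \<open>- (\<alpha> + \<beta>)\<close> would lie in \<open>P\<close>, and so would
  \<open>- \<alpha> = - (\<alpha> + \<beta>) + \<beta>\<close>.\<close>

lemma nilradical_add:
  assumes P: "parabolic \<Delta> P" and "\<alpha> \<in> nilradical P" "\<beta> \<in> P" "\<alpha> + \<beta> \<in> \<Delta>"
  shows "\<alpha> + \<beta> \<in> nilradical P"
proof -
  have "- \<alpha> \<in> \<Delta>" using nilradical_subset[OF P] parabolic_uminus[OF P] assms(2) by blast
  then have "- (\<alpha> + \<beta>) \<notin> P"
    using parabolic_add[OF P, of "- (\<alpha> + \<beta>)" \<beta>] assms by (auto simp: in_nilradical_iff)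
  moreover have "\<alpha> + \<beta> \<in> P" using parabolic_add[OF P] assms by (auto simp: in_nilradical_iff)
  ultimately show ?thesis by (simp add: in_nilradical_iff)
qed

text \<open>If neither summand is in the nilradical, their negatives are in \<open>P\<close>, and so is the negative of the sum.\<close>

lemma nilradical_sum_cases:
  assumes P: "parabolic \<Delta> P" and "\<alpha> \<in> \<Delta>" "\<beta> \<in> \<Delta>" "\<alpha> + \<beta> \<in> nilradical P"
  shows "\<alpha> \<in> nilradical P \<or> \<beta> \<in> nilradical P"
proof (rule ccontr)
  assume "\<not> ?thesis"
  then have "- \<alpha> \<in> P" "- \<beta> \<in> P" using parabolic_not_nilradical[OF P] assms by blast+
  moreover have "- \<alpha> + - \<beta> \<in> \<Delta>"
    using parabolic_uminus[OF P] nilradical_subset[OF P] assms(4) by fastforce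
  ultimately have "- (\<alpha> + \<beta>) \<in> P" using parabolic_add[OF P, of "- \<alpha>" "- \<beta>"] by simp
  then show False using assms(4) by (simp add: in_nilradical_iff)
qed

lemma (in lie_superalgebra) cominuscule_br_eq_0:
  assumes "cominuscule h P" "\<alpha> \<in> nilradical P" "\<beta> \<in> nilradical P"
    "x \<in> root_space h \<alpha>" "y \<in> root_space h \<beta>"
  shows "br x y = 0"
  using assms span_base unfolding cominuscule_def abelian_def by blast

lemma odd_root_vectors:
  "(0, 0, oct_h, 0) \<in> G3.root_space g3_cartan half_gamma"
  "(0, 0, 0, oct_h) \<in> G3.root_space g3_cartan (- half_gamma)"
  "(0, 0, oct_up i, 0) \<in> G3.root_space g3_cartan (eps i + half_gamma)"
  "(0, 0, 0, oct_low i) \<in> G3.root_space g3_cartan (- eps i - half_gamma)"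
  using root_vector_odd[OF g3_dual_basic(3) _ basis_weights(1)]
    root_vector_odd(1)[OF g3_dual_basic(1) _ basis_weights(2)]
    root_vector_odd(2)[OF g3_dual_lin(3)[OF g3_dual_basic(1)] _ basis_weights(3)]
  by (simp_all only: otrace.simps add_0 diff_0 right_minus simp_thms)

text \<open>Since \<open>oct_h\<close> has square 1, the square of \<open>oct_h \<otimes> e\<^sub>1\<close> is a nonzero multiple of the root vector of
  weight \<open>\<gamma>\<close> in \<open>sl(2)\<close>; likewise \<open>oct_h \<otimes> e\<^sub>2\<close> and \<open>- \<gamma>\<close>.\<close>

lemma g3_br_half_gamma:
  "g3_br (0, 0, oct_h, 0) (0, 0, oct_h, 0) \<noteq> 0"
  "g3_br (0, 0, 0, oct_h) (0, 0, 0, oct_h) \<noteq> 0"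
  by (simp_all add: g3_br_odd_odd zero_g3 odd_sl2_def dot3_def vec_eq_iff forall_2 vector_2 Let_def del: g3_br.simps)

lemma g3_br_odd_roots:
  assumes "i \<noteq> j"
  shows "g3_br (0, 0, oct_up i, 0) (0, 0, 0, oct_low j) \<noteq> 0"
  using inner_der_nonzero(1)[OF assms] by (simp add: g3_br_odd_odd zero_g3 del: g3_br.simps)

abbreviation g3_all_roots :: "(g3 \<Rightarrow> complex) set" where
  "g3_all_roots \<equiv> g3_even_roots \<union> g3_odd_roots"

lemma g3_all_rootsI:
  "eps i \<in> g3_all_roots" "- eps i \<in> g3_all_roots"
  "half_gamma \<in> g3_all_roots" "- half_gamma \<in> g3_all_roots"
  "eps i + half_gamma \<in> g3_all_roots" "- eps i - half_gamma \<in> g3_all_roots"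
  "half_gamma + half_gamma \<in> g3_all_roots" "- half_gamma + - half_gamma \<in> g3_all_roots"
  using g3_even_rootsI(2,3)[of i] g3_even_rootsI(4,5) g3_odd_rootsI(1,2) g3_odd_rootsI(3,6)[of i]
  by (simp_all add: gamma_def)

lemma eps_split: "\<exists>j k. j \<noteq> i \<and> k \<noteq> i \<and> eps i = - eps j + - eps k"
proof -
  have "eps 1 = - eps 2 + - eps 3" "eps 2 = - eps 1 + - eps 3" "eps 3 = - eps 1 + - eps 2"
    using eps_sum by (simp_all add: eq_neg_iff_add_eq_0 add_ac eq_diff_eq)
  moreover have "(1::3) \<noteq> 2" "(1::3) \<noteq> 3" "(2::3) \<noteq> 3" by simp_all
  ultimately show ?thesis using exhaust_3[of i] by metis
qed

text \<open>The Levi part contains \<open>\<plusminus>h\<close>, so the relations among the weights of \<open>G\<^sub>2\<close> can be used in the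
  nilradical modulo \<open>h\<close>.  The conclusion is about the odd roots above \<open>\<epsilon>\<^sub>i\<close> and \<open>- \<epsilon>\<^sub>j\<close> because
  the bracket of their root vectors is immediate from the definition: it is the inner derivation that spans
  the root space of \<open>\<epsilon>\<^sub>i - \<epsilon>\<^sub>j\<close>.\<close>

lemma nilradical_opposite_odd_roots:
  assumes P: "parabolic g3_all_roots P"
    and h: "half_gamma \<notin> nilradical P" "- half_gamma \<notin> nilradical P"
  shows "\<exists>i j. i \<noteq> j \<and> eps i + half_gamma \<in> nilradical P \<and> - eps j - half_gamma \<in> nilradical P"
proof -
  let ?N = "nilradical P"
  have hP: "half_gamma \<in> P" "- half_gamma \<in> P"
    using parabolic_not_nilradical[OF P] h g3_all_rootsI(3,4) by force+
  have add: "\<alpha> + \<beta> \<in> ?N" if "\<alpha> \<in> ?N" "\<beta> \<in> P" "\<alpha> + \<beta> \<in> g3_all_roots" for \<alpha> \<beta>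
    using nilradical_add[OF P that] .
  have split: "\<alpha> \<in> ?N \<or> \<beta> \<in> ?N" if "\<alpha> + \<beta> \<in> ?N" "\<alpha> \<in> g3_all_roots" "\<beta> \<in> g3_all_roots" for \<alpha> \<beta>
    using nilradical_sum_cases[OF P] that by blast
  have gamma: "gamma \<notin> ?N" "- gamma \<notin> ?N"
    using parabolic_add[OF P hP(1) hP(1) g3_all_rootsI(7)] parabolic_add[OF P hP(2) hP(2) g3_all_rootsI(8)]
    by (simp_all add: in_nilradical_iff gamma_def)
  obtain \<alpha> where \<alpha>: "\<alpha> \<in> ?N" using nilradical_nonempty[OF P] by blast
  then have "\<alpha> \<in> g3_all_roots" using nilradical_subset[OF P] by blast
  then consider i j where "\<alpha> = eps i + - eps j" | i where "\<alpha> = eps i" | i where "\<alpha> = - eps i"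
    | "\<alpha> \<in> {gamma, - gamma, half_gamma, - half_gamma}"
    | i where "\<alpha> + half_gamma = eps i \<or> \<alpha> + - half_gamma = eps i"
    | i where "\<alpha> + half_gamma = - eps i \<or> \<alpha> + - half_gamma = - eps i"
    unfolding g3_even_roots_def g3_odd_roots_def by fastforce
  then have "\<exists>i. eps i \<in> ?N \<or> - eps i \<in> ?N"
  proof cases
    case 1
    then show ?thesis using \<alpha> split g3_all_rootsI(1,2) by metis
  next
    case 4
    then show ?thesis using \<alpha> gamma h by auto
  next
    case (5 i)
    then show ?thesis using add[OF \<alpha> hP(1)] add[OF \<alpha> hP(2)] g3_all_rootsI(1)[of i] by metis
  next
    case (6 i)
    then show ?thesis using add[OF \<alpha> hP(1)] add[OF \<alpha> hP(2)] g3_all_rootsI(2)[of i] by metis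
  qed (use \<alpha> in auto)
  then obtain i where i: "eps i \<in> ?N \<or> - eps i \<in> ?N" by blast
  \<comment> \<open>Splitting \<open>\<epsilon>\<^sub>i = - \<epsilon>\<^sub>j - \<epsilon>\<^sub>k\<close>, or its negative, gives a short root of the opposite sign
    whose index differs from \<open>i\<close>.\<close>
  obtain j k where jk: "j \<noteq> i" "k \<noteq> i" "eps i = - eps j + - eps k" using eps_split by blast
  then have "- eps i = eps j + eps k" by simp
  then have "\<exists>m n. m \<noteq> n \<and> eps m \<in> ?N \<and> - eps n \<in> ?N"
    using i jk split g3_all_rootsI(1,2) by metis
  then show ?thesis
    using add[OF _ hP(1) g3_all_rootsI(5)] add[of "- eps _", OF _ hP(2)] g3_all_rootsI(6)
    by (metis add_uminus_conv_diff)
qed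

theorem theorem2p13:
  shows "\<not> (\<exists>P. G3.cominuscule g3_cartan P)"
proof
  assume "\<exists>P. G3.cominuscule g3_cartan P"
  then obtain P where P: "G3.cominuscule g3_cartan P" by blast
  note br_0 = G3.cominuscule_br_eq_0[OF P]
  have "parabolic g3_all_roots P" using P by (simp add: G3.cominuscule_def g3_roots)
  moreover have "half_gamma \<notin> nilradical P" "- half_gamma \<notin> nilradical P"
    using br_0 odd_root_vectors(1,2) g3_br_half_gamma by blast+
  ultimately obtain i j where "i \<noteq> j" "eps i + half_gamma \<in> nilradical P" "- eps j - half_gamma \<in> nilradical P"
    using nilradical_opposite_odd_roots by blast
  then show False using br_0 odd_root_vectors(3,4) g3_br_odd_roots by blast
qed

end
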